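(* Let $\Psi$ be a growth function of order $p\in(1/2,1]$. Then there exists a constant $M_{\Psi,p}>0$ such that $$\sum_{n=1}^\infty\frac{|f_n|}{\Psi^{-1}(n)}\le M_{\Psi,p}\,\|F\|_{H^\Psi(\mathbb{D})}$$ for all $F(z)=\sum_{n\ge0}f_nz^n$ in $H^\Psi(\mathbb{D})$.
   Context: $\mathbb{D}$ is the open unit disc. Growth function of order $p\in(0,1]$: a function $\Psi:[0,\infty)\to[0,\infty)$ that is continuous and (strictly) increasing with $\Psi(0)=0$, $\lim_{t\to\infty}\Psi(t)=\infty$, such that $t\mapsto t^{-1}\Psi(t)$ is non-increasing on $(0,\infty)$, and of lower type $p$: there is $c>0$ with $\Psi(st)\le c\,s^p\,\Psi(t)$ for all $t\ge0$, $s\in(0,1)$. $\Psi^{-1}$ is the inverse function of $\Psi$. $H^\Psi(\mathbb{D})$ is the class of holomorphic $F$ on $\mathbb{D}$ with $\sup_{0\le r<1}\int_{[0,1)}\Psi(|F(re^{i2\pi\theta})|)\,d\theta<\infty$, with $$\|F\|_{H^\Psi(\mathbb{D})}=\inf\Big\{\alpha>0:\sup_{0\le r<1}\int_{[0,1)}\Psi(\alpha^{-1}|F(re^{i2\pi\theta})|)\,d\theta\le1\Big\}.$$ *)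

theory Defs
  imports "HOL-Complex_Analysis.Complex_Analysis"
begin

text \<open>
  Functions on \<open>[0,\<infinity>)\<close> are represented by total functions on the reals; their values at negative
  arguments are unconstrained and never used.
\<close>

definition growth_function :: "(real \<Rightarrow> real) \<Rightarrow> real \<Rightarrow> bool" where
  "growth_function \<Psi> p \<longleftrightarrow>
     p \<in> {0<..1} \<and>
     \<Psi> \<in> {0..} \<rightarrow> {0..} \<and>
     continuous_on {0..} \<Psi> \<and>
     strict_mono_on {0..} \<Psi> \<and>
     \<Psi> 0 = 0 \<and>
     filterlim \<Psi> at_top at_top \<and>
     antimono_on {0<..} (\<lambda>t. \<Psi> t / t) \<and>
     (\<exists>c>0. \<forall>t\<ge>0. \<forall>s\<in>{0<..<1}. \<Psi> (s * t) \<le> c * s powr p * \<Psi> t)"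

definition growth_inv :: "(real \<Rightarrow> real) \<Rightarrow> real \<Rightarrow> real" where
  "growth_inv \<Psi> = the_inv_into {0..} \<Psi>"

text \<open>
  The supremum over \<open>r\<close> of the circle means of \<open>\<Psi>(|F|)\<close>, as an extended nonnegative real, so that
  an infinite supremum is not confused with a default value.
\<close>

definition hardy_modular :: "(real \<Rightarrow> real) \<Rightarrow> (complex \<Rightarrow> complex) \<Rightarrow> ennreal" where
  "hardy_modular \<Psi> F =
     (SUP r\<in>{0..<1}. \<integral>\<^sup>+\<theta>\<in>{0..<1}. ennreal (\<Psi> (cmod (F (of_real r * cis (2 * pi * \<theta>))))) \<partial>lborel)"

definition hardy_orlicz :: "(real \<Rightarrow> real) \<Rightarrow> (complex \<Rightarrow> complex) set" where
  "hardy_orlicz \<Psi> = {F. F holomorphic_on ball 0 1 \<and> hardy_modular \<Psi> F < \<infinity>}"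

text \<open>
  For a growth function \<open>\<Psi>\<close> and \<open>F \<in> hardy_orlicz \<Psi>\<close> the set below is nonempty, by the lower type
  condition, so the real infimum is the intended one.
\<close>

definition hardy_orlicz_norm :: "(real \<Rightarrow> real) \<Rightarrow> (complex \<Rightarrow> complex) \<Rightarrow> real" where
  "hardy_orlicz_norm \<Psi> F =
     Inf {\<alpha>. \<alpha> > 0 \<and> hardy_modular \<Psi> (\<lambda>z. F z / of_real \<alpha>) \<le> 1}"

end

theory Submission
  imports Defs
begin

text \<open>
  Normalise \<open>F\<close> so that all circle means of \<open>\<Psi>(|F|)\<close> are at most \<open>1\<close>; it is then enough to bound the
  finite partial sums by a constant depending on \<open>\<Psi>\<close> and \<open>p\<close> only. Replacing \<open>F\<close> by \<open>F(Rz)\<close>, with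
  \<open>R\<close> close to \<open>1\<close> and no zero of \<open>F\<close> of modulus \<open>R\<close>, makes \<open>F\<close> holomorphic beyond the closed disc
  and free of zeros on the unit circle.

  Since \<open>\<phi>(n) = n / \<Psi>\<^sup>-\<^sup>1(n)\<close> is non-increasing, summation by parts over the blocks \<open>[4\<^sup>j, 4\<^sup>j\<^sup>+\<^sup>1)\<close>
  (\<open>base4_summation_by_parts\<close>) bounds \<open>\<Sum> |f\<^sub>n| / \<Psi>\<^sup>-\<^sup>1(n)\<close> by \<open>\<Sum>\<^sub>j w\<^sub>j S\<^sub>j\<close>, where the \<open>w\<^sub>j\<close> are the
  decrements of \<open>\<phi>\<close> along the powers of \<open>4\<close>, the last one being a value of \<open>\<phi>\<close> itself, and \<open>S\<^sub>j\<close> is the sum of \<open>|f\<^sub>n| / n\<close> over \<open>1 \<le> n < 4\<^sup>j\<^sup>+\<^sup>1\<close>.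
  Hardy's inequality on the circle of radius \<open>r\<^sub>j = 1 - 4\<^sup>-\<^sup>j/8\<close> controls each \<open>S\<^sub>j\<close> by an \<open>L\<^sup>1\<close> mean.

  Dividing out the zeros of \<open>F\<close> by Blaschke factors gives \<open>F = B H\<^sup>4\<close> with \<open>|B| \<le> 1\<close> in the disc and
  \<open>|H|\<^sup>4 = |F|\<close> on the circle (\<open>blaschke_root_factorization\<close>). The same factorisation serves twice:
  Hardy's inequality follows from \<open>F = (B H\<^sup>2) (H\<^sup>2)\<close>, Bessel's and Hilbert's inequalities
  (\<open>hardy_inequality_factored\<close>), so that \<open>S\<^sub>j\<close> is at most a constant times the mean of
  \<open>|H(r\<^sub>j e\<^sup>i\<^sup>x)|\<^sup>4\<close>; and Poisson's formula bounds \<open>|H|\<close> inside by the Poisson integral of the boundary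
  function \<open>V = |H|\<close>, for which the mean of \<open>\<Psi>(V\<^sup>4)\<close> is at most \<open>1\<close>.

  It remains to bound \<open>\<Sum>\<^sub>j w\<^sub>j \<integral> (P\<^sub>j V)\<^sup>4\<close>, where \<open>P\<^sub>j\<close> is the Poisson integral at radius \<open>r\<^sub>j\<close>
  (\<open>weighted_poisson_integrals_le\<close>). The argument is the one that proves Marcinkiewicz interpolation: for
  each \<open>j\<close> cut \<open>V\<close> at the level \<open>V\<^sup>4 = \<Psi>\<^sup>-\<^sup>1(4\<^sup>j)\<close>. On the small part Jensen's inequality lets \<open>P\<^sub>j\<close>
  disappear, and the sum over \<open>j\<close> telescopes to at most \<open>\<Psi>(V\<^sup>4)\<close>, because \<open>\<Psi>(t)/t\<close> is non-increasing. On the large part the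
  kernel is at most \<open>16 \<cdot> 4\<^sup>j\<close>, and the lower type condition with \<open>p/2 > 1/4\<close> gives a factor
  \<open>(\<Psi>(V\<^sup>4)/4\<^sup>j)\<^sup>1\<^sup>/\<^sup>2\<close>, which makes the sum over \<open>j\<close> geometric. This is where \<open>p > 1/2\<close> enters.
\<close>

section \<open>Hilbert's inequality for Cauchy products\<close>

text \<open>
  Integral comparison: \<open>2 arctan (sqrt (x/K)) / sqrt K\<close> is a primitive of \<open>1 / ((K + x) sqrt x)\<close>, so
  each summand is at most an increment of this primitive.
\<close>

lemma schur_weight_sum:
  fixes k N :: nat
  shows "(\<Sum>l\<le>N. 1 / (real (k + l + 2) * sqrt (real (l + 1)))) \<le> pi / sqrt (real (k + 1))"
proof -
  define K where "K = real (k + 1)"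
  have K: "K > 0" by (simp add: K_def)
  define A where "A = (\<lambda>l::nat. arctan (sqrt (real l / K)))"
  have step: "1 / (real (k + l + 2) * sqrt (real (l + 1))) \<le> 2 / sqrt K * (A (Suc l) - A l)" for l
  proof -
    define a where "a = sqrt (real l / K)"
    define b where "b = sqrt (real (l + 1) / K)"
    have ab: "0 \<le> a" "a < b" "b > 0"
      using K by (auto simp: a_def b_def intro!: real_sqrt_less_mono divide_strict_right_mono)
    have "\<exists>z>a. z < b \<and> arctan b - arctan a = (b - a) * inverse (1 + z\<^sup>2)"
      by (rule MVT2) (use ab in \<open>auto intro!: DERIV_arctan\<close>)
    then obtain z where z: "a < z" "z < b" "arctan b - arctan a = (b - a) * inverse (1 + z\<^sup>2)"
      by blast
    have "z\<^sup>2 \<le> b\<^sup>2" using z ab by (intro power_mono) auto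
    then have secant: "(b - a) * inverse (1 + b\<^sup>2) \<le> arctan b - arctan a"
      unfolding z(3) using ab by (intro mult_left_mono le_imp_inverse_le) (auto simp: add_pos_nonneg)
    have e: "b\<^sup>2 = real (l + 1) / K" "a\<^sup>2 = real l / K"
      using K by (auto simp: a_def b_def)
    have "(b - a) * (2 * b) \<ge> (b - a) * (b + a)"
      using ab by (intro mult_left_mono) auto
    then have sq: "(b - a) * (2 * b) \<ge> b\<^sup>2 - a\<^sup>2" by (simp add: power2_eq_square algebra_simps)
    have "b\<^sup>2 - a\<^sup>2 = 1 / K" using e by (simp add: add_divide_distrib)
    then have "inverse (1 + b\<^sup>2) * (1 / K) \<le> inverse (1 + b\<^sup>2) * ((b - a) * (2 * b))"
      using sq by (intro mult_left_mono) (auto simp: add_pos_nonneg)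
    also have "\<dots> = ((b - a) * inverse (1 + b\<^sup>2)) * (2 * b)" by simp
    also have "\<dots> \<le> (arctan b - arctan a) * (2 * b)"
      using secant ab by (intro mult_right_mono) auto
    finally have 1: "inverse (1 + real (l + 1) / K) * (1 / K) \<le> (A (Suc l) - A l) * (2 * b)"
      unfolding e(1) by (simp add: A_def a_def b_def add.commute)
    have "inverse (1 + real (l + 1) / K) * (1 / K) = 1 / real (k + l + 2)"
      using K by (simp add: field_simps K_def)
    then have "1 / real (k + l + 2) \<le> (A (Suc l) - A l) * (2 * b)" using 1 by simp
    then have "1 / real (k + l + 2) / sqrt (real (l + 1)) \<le> (A (Suc l) - A l) * (2 * b) / sqrt (real (l + 1))"
      by (intro divide_right_mono) auto
    also have "\<dots> = 2 / sqrt K * (A (Suc l) - A l)"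
      using K by (simp add: b_def real_sqrt_divide field_simps)
    finally show ?thesis by simp
  qed
  have "(\<Sum>l\<le>N. 1 / (real (k + l + 2) * sqrt (real (l + 1)))) \<le> (\<Sum>l\<le>N. 2 / sqrt K * (A (Suc l) - A l))"
    by (intro sum_mono step)
  also have "\<dots> = 2 / sqrt K * (A (Suc N) - A 0)"
    unfolding sum_distrib_left[symmetric] lessThan_Suc_atMost[symmetric] by (simp only: sum_lessThan_telescope)
  also have "\<dots> \<le> 2 / sqrt K * (pi / 2)"
    using K arctan_ubound[of "sqrt (real (Suc N) / K)"] by (intro mult_left_mono) (auto simp: A_def)
  finally show ?thesis by (simp add: K_def)
qed

text \<open>
  Schur's test: the arithmetic-geometric mean inequality, weighted by \<open>sqrt ((k + 1) / (l + 1))\<close>, splits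
  the double sum into two sums whose inner sums are bounded by \<open>schur_weight_sum\<close>.
\<close>

lemma hilbert_inequality_schur:
  fixes x y :: "nat \<Rightarrow> real"
  assumes x: "\<And>k. 0 \<le> x k" and y: "\<And>k. 0 \<le> y k"
  shows "(\<Sum>k\<le>N. \<Sum>l\<le>N. x k * y l / real (k + l + 2)) \<le> pi / 2 * ((\<Sum>k\<le>N. (x k)\<^sup>2) + (\<Sum>l\<le>N. (y l)\<^sup>2))"
proof -
  have half: "(\<Sum>k\<le>N. \<Sum>l\<le>N. (x k)\<^sup>2 * (sqrt (real (k + 1)) / sqrt (real (l + 1))) / real (k + l + 2))
       \<le> pi * (\<Sum>k\<le>N. (x k)\<^sup>2)" for x :: "nat \<Rightarrow> real"
  proof -
    have "(\<Sum>l\<le>N. (x k)\<^sup>2 * (sqrt (real (k + 1)) / sqrt (real (l + 1))) / real (k + l + 2)) \<le> pi * (x k)\<^sup>2" for k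
    proof -
      have "(\<Sum>l\<le>N. (x k)\<^sup>2 * (sqrt (real (k + 1)) / sqrt (real (l + 1))) / real (k + l + 2))
          = (x k)\<^sup>2 * sqrt (real (k + 1)) * (\<Sum>l\<le>N. 1 / (real (k + l + 2) * sqrt (real (l + 1))))"
        by (simp add: sum_distrib_left field_simps)
      also have "\<dots> \<le> (x k)\<^sup>2 * sqrt (real (k + 1)) * (pi / sqrt (real (k + 1)))"
        by (intro mult_left_mono schur_weight_sum) auto
      finally show ?thesis by (simp add: mult.commute)
    qed
    then show ?thesis unfolding sum_distrib_left by (intro sum_mono)
  qed
  have amgm: "x k * y l / real (k + l + 2) \<le>
      (1/2) * ((x k)\<^sup>2 * (sqrt (real (k + 1)) / sqrt (real (l + 1))) / real (k + l + 2)) +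
      (1/2) * ((y l)\<^sup>2 * (sqrt (real (l + 1)) / sqrt (real (k + 1))) / real (l + k + 2))" for k l
  proof -
    define u where "u = sqrt (real (k + 1))"
    define v where "v = sqrt (real (l + 1))"
    have uv: "u > 0" "v > 0" by (auto simp: u_def v_def)
    have "0 \<le> (x k * u - y l * v)\<^sup>2" by simp
    then have "2 * (x k * y l) * (u * v) \<le> (x k)\<^sup>2 * u\<^sup>2 + (y l)\<^sup>2 * v\<^sup>2"
      by (simp add: power2_eq_square algebra_simps)
    then have "2 * (x k * y l) \<le> ((x k)\<^sup>2 * u\<^sup>2 + (y l)\<^sup>2 * v\<^sup>2) / (u * v)"
      using uv by (simp add: pos_le_divide_eq)
    also have "\<dots> = (x k)\<^sup>2 * (u / v) + (y l)\<^sup>2 * (v / u)"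
      using uv by (simp add: field_simps power2_eq_square)
    finally have "x k * y l / real (k + l + 2) \<le> ((x k)\<^sup>2 * (u / v) + (y l)\<^sup>2 * (v / u)) / 2 / real (k + l + 2)"
      by (intro divide_right_mono) auto
    also have "\<dots> = (1/2) * ((x k)\<^sup>2 * (u / v) / real (k + l + 2)) + (1/2) * ((y l)\<^sup>2 * (v / u) / real (l + k + 2))"
      by (simp add: add_divide_distrib add.commute mult_ac)
    finally show ?thesis by (simp add: u_def v_def)
  qed
  have "(\<Sum>k\<le>N. \<Sum>l\<le>N. x k * y l / real (k + l + 2)) \<le>
     (\<Sum>k\<le>N. \<Sum>l\<le>N. (1/2) * ((x k)\<^sup>2 * (sqrt (real (k + 1)) / sqrt (real (l + 1))) / real (k + l + 2)) +
      (1/2) * ((y l)\<^sup>2 * (sqrt (real (l + 1)) / sqrt (real (k + 1))) / real (l + k + 2)))"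
    by (intro sum_mono amgm)
  also have "\<dots> = (1/2) * (\<Sum>k\<le>N. \<Sum>l\<le>N. (x k)\<^sup>2 * (sqrt (real (k + 1)) / sqrt (real (l + 1))) / real (k + l + 2))
     + (1/2) * (\<Sum>k\<le>N. \<Sum>l\<le>N. (y l)\<^sup>2 * (sqrt (real (l + 1)) / sqrt (real (k + 1))) / real (l + k + 2))"
    unfolding sum.distrib sum_distrib_left ..
  also have "(\<Sum>k\<le>N. \<Sum>l\<le>N. (y l)\<^sup>2 * (sqrt (real (l + 1)) / sqrt (real (k + 1))) / real (l + k + 2))
     = (\<Sum>l\<le>N. \<Sum>k\<le>N. (y l)\<^sup>2 * (sqrt (real (l + 1)) / sqrt (real (k + 1))) / real (l + k + 2))"
    by (rule sum.swap)
  also have "(1/2) * (\<Sum>k\<le>N. \<Sum>l\<le>N. (x k)\<^sup>2 * (sqrt (real (k + 1)) / sqrt (real (l + 1))) / real (k + l + 2)) + (1/2) * \<dots>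
      \<le> (1/2) * (pi * (\<Sum>k\<le>N. (x k)\<^sup>2)) + (1/2) * (pi * (\<Sum>l\<le>N. (y l)\<^sup>2))"
    by (intro add_mono mult_left_mono half) auto
  finally show ?thesis by (simp add: algebra_simps)
qed

lemma cauchy_product_hilbert:
  fixes x y z :: "nat \<Rightarrow> real"
  assumes x: "\<And>k. 0 \<le> x k" and y: "\<And>k. 0 \<le> y k"
    and z: "\<And>n. z n \<le> (\<Sum>k\<le>n. x k * y (n - k))"
  shows "(\<Sum>n\<le>N. z n / real (n + 2)) \<le> pi / 2 * ((\<Sum>k\<le>N. (x k)\<^sup>2) + (\<Sum>l\<le>N. (y l)\<^sup>2))"
proof -
  have "(\<Sum>n\<le>N. z n / real (n + 2)) \<le> (\<Sum>n\<le>N. \<Sum>k\<le>n. x k * y (n - k) / real (k + (n - k) + 2))"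
  proof (intro sum_mono)
    fix n
    have "z n / real (n + 2) \<le> (\<Sum>k\<le>n. x k * y (n - k)) / real (n + 2)"
      by (intro divide_right_mono z) auto
    then show "z n / real (n + 2) \<le> (\<Sum>k\<le>n. x k * y (n - k) / real (k + (n - k) + 2))"
      by (simp add: sum_divide_distrib)
  qed
  also have "\<dots> = (\<Sum>(k, l)\<in>{(k, l). k + l \<le> N}. x k * y l / real (k + l + 2))"
    by (simp add: sum.triangle_reindex_eq)
  also have "\<dots> \<le> (\<Sum>(k, l)\<in>{..N} \<times> {..N}. x k * y l / real (k + l + 2))"
    by (rule sum_mono2) (use x y in auto)
  also have "\<dots> = (\<Sum>k\<le>N. \<Sum>l\<le>N. x k * y l / real (k + l + 2))"
    by (simp add: sum.cartesian_product)
  also have "\<dots> \<le> pi / 2 * ((\<Sum>k\<le>N. (x k)\<^sup>2) + (\<Sum>l\<le>N. (y l)\<^sup>2))"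
    by (rule hilbert_inequality_schur[OF x y])
  finally show ?thesis .
qed

section \<open>Means over circles and Taylor coefficients\<close>

text \<open>
  The circle is parametrised by \<open>[0,1]\<close> with Lebesgue measure, a probability space; means over the
  circle of radius \<open>r\<close> are then integrals of functions of \<open>r * circ t\<close>.
\<close>

definition unit_interval :: "real measure" where
  "unit_interval = restrict_space lborel {0..1}"

definition circ :: "real \<Rightarrow> complex" where
  "circ t = cis (2 * pi * t)"

lemma norm_circ [simp]: "cmod (circ t) = 1"
  and circ_nonzero [simp]: "circ t \<noteq> 0"
  and circ_cnj: "circ t * cnj (circ t) = 1"
  and continuous_on_circ [continuous_intros]: "continuous_on A circ"
  by (auto simp: circ_def cis_mult cis_cnj intro!: continuous_intros)

lemma space_unit_interval [simp]: "space unit_interval = {0..1}"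
  by (simp add: unit_interval_def space_restrict_space)

lemma emeasure_unit_interval: "emeasure unit_interval (space unit_interval) = 1"
  by (simp add: unit_interval_def space_restrict_space emeasure_restrict_space)

lemma finite_measure_unit_interval: "finite_measure unit_interval"
  by (rule finite_measureI) (simp add: emeasure_unit_interval del: space_unit_interval)

lemma borel_measurable_unit_intervalI:
  "f \<in> borel_measurable borel \<Longrightarrow> f \<in> borel_measurable unit_interval"
  unfolding unit_interval_def by (intro measurable_restrict_space1) simp

lemma continuous_unit_interval_integral:
  fixes f :: "real \<Rightarrow> 'a :: euclidean_space"
  assumes "continuous_on {0..1} f"
  shows "integrable unit_interval f" "(f has_integral (LINT t|unit_interval. f t)) {0..1}"
proof -
  have i: "set_integrable lborel {0..1} f"
    by (rule borel_integrable_atLeastAtMost'[OF assms])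
  then show "integrable unit_interval f"
    by (simp add: unit_interval_def set_integrable_def integrable_restrict_space)
  have "(LINT t|unit_interval. f t) = (LINT t:{0..1}|lborel. f t)"
    by (simp add: unit_interval_def set_lebesgue_integral_def integral_restrict_space)
  then show "(f has_integral (LINT t|unit_interval. f t)) {0..1}"
    using set_borel_integral_eq_integral[OF i] by (simp add: has_integral_integrable_integral)
qed

text \<open>
  On the circle, \<open>dw = 2 \<pi> \<i> w dt\<close>; this turns Cauchy's formulas into statements about means.
\<close>

lemma has_contour_integral_circle_mean:
  assumes G: "(G has_contour_integral (2 * of_real pi * \<i> * I)) (circlepath 0 r)"
    and cont: "continuous_on (sphere 0 r) G" and r: "r \<ge> 0"
  shows "(LINT t|unit_interval. G (of_real r * circ t) * (of_real r * circ t)) = I"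
proof -
  let ?f = "\<lambda>t. G (of_real r * circ t) * (of_real r * circ t)"
  have c: "continuous_on {0..1} ?f"
    by (intro continuous_intros continuous_on_compose2[OF cont]) (use r in \<open>auto simp: norm_mult\<close>)
  have "((\<lambda>t. G (circlepath 0 r t) * vector_derivative (circlepath 0 r) (at t within {0..1}))
      has_integral (2 * of_real pi * \<i> * I)) {0..1}"
    using G by (simp add: has_contour_integral_def)
  also have "?this \<longleftrightarrow> ((\<lambda>t. (2 * of_real pi * \<i>) * ?f t) has_integral (2 * of_real pi * \<i> * I)) {0..1}"
  proof (intro has_integral_cong)
    fix t :: real assume t: "t \<in> {0..1}"
    have e: "exp (2 * of_real pi * \<i> * of_real t) = circ t"
      by (simp add: circ_def cis_conv_exp mult_ac)
    have "circlepath 0 r t = of_real r * circ t"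
      unfolding circlepath e by simp
    moreover have "vector_derivative (circlepath 0 r) (at t within {0..1}) = 2 * of_real pi * \<i> * of_real r * circ t"
      using t by (simp add: vector_derivative_circlepath01 e)
    ultimately show "G (circlepath 0 r t) * vector_derivative (circlepath 0 r) (at t within {0..1})
        = (2 * of_real pi * \<i>) * ?f t" by simp
  qed
  finally have "((\<lambda>t. (1 / (2 * of_real pi * \<i>)) * ((2 * of_real pi * \<i>) * ?f t)) has_integral
       (1 / (2 * of_real pi * \<i>)) * (2 * of_real pi * \<i> * I)) {0..1}"
    by (rule has_integral_mult_right)
  then have "(?f has_integral I) {0..1}" by simp
  then show ?thesis
    using continuous_unit_interval_integral(2)[OF c] has_integral_unique by blast
qed

lemma taylor_coefficient_circle_mean:
  assumes A: "A holomorphic_on ball 0 1" and r: "0 < r" "r < 1"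
  shows "(LINT t|unit_interval. A (of_real r * circ t) * cnj (circ t) ^ k)
     = of_real (r ^ k) * ((deriv ^^ k) A 0 / fact k)"
proof -
  have c: "continuous_on (cball 0 r) A"
    using r by (intro holomorphic_on_imp_continuous_on holomorphic_on_subset[OF A]) auto
  have "((\<lambda>u. A u / (u - 0) ^ Suc k) has_contour_integral 2 * of_real pi * \<i> / fact k * (deriv ^^ k) A 0)
      (circlepath 0 r)"
    using Cauchy_has_contour_integral_higher_derivative_circlepath[OF c holomorphic_on_subset[OF A], of 0 k] r
    by (simp add: subset_ball)
  then have "((\<lambda>u. A u / u ^ Suc k) has_contour_integral 2 * of_real pi * \<i> * ((deriv ^^ k) A 0 / fact k))
      (circlepath 0 r)" by simp
  then have "(LINT t|unit_interval. A (of_real r * circ t) / (of_real r * circ t) ^ Suc k * (of_real r * circ t))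
      = (deriv ^^ k) A 0 / fact k"
    by (rule has_contour_integral_circle_mean)
       (use r in \<open>auto intro!: continuous_intros continuous_on_subset[OF c]\<close>)
  moreover have "A (of_real r * circ t) / (of_real r * circ t) ^ Suc k * (of_real r * circ t) =
      of_real (1 / r ^ k) * (A (of_real r * circ t) * cnj (circ t) ^ k)" for t
  proof -
    have e: "cnj (circ t) = 1 / circ t" using circ_cnj[of t] by (simp add: field_simps)
    show ?thesis unfolding e using r by (simp add: field_simps power_divide)
  qed
  ultimately have "of_real (1 / r ^ k) * (LINT t|unit_interval. A (of_real r * circ t) * cnj (circ t) ^ k)
      = (deriv ^^ k) A 0 / fact k" by simp
  then show ?thesis using r by (simp add: field_simps)
qed

lemma power_series_coefficient:
  fixes f :: "nat \<Rightarrow> complex"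
  assumes "\<And>z. z \<in> ball 0 1 \<Longrightarrow> (\<lambda>n. f n * z ^ n) sums F z"
  shows "(deriv ^^ n) F 0 / fact n = f n"
proof -
  have "\<forall>\<^sub>F z in nhds 0. z \<in> ball (0 :: complex) 1"
    by (rule eventually_nhds_in_open) auto
  then have "\<forall>\<^sub>F z in nhds 0. (\<lambda>n. fps_nth (Abs_fps f) n * z ^ n) sums F z"
    by eventually_elim (simp add: assms)
  then have "F has_fps_expansion Abs_fps f"
    by (rule has_fps_expansionI)
  from fps_nth_fps_expansion[OF this, of n] show ?thesis by simp
qed

text \<open>
  Bessel's inequality for the orthogonal system of powers of \<open>z\<close>: the Taylor polynomial \<open>S\<close> has the same
  pairing with \<open>A\<close> and with itself, namely the sum \<open>Q\<close> of squares, so the mean of \<open>|A - S|\<^sup>2\<close> is the mean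
  of \<open>|A|\<^sup>2\<close> minus \<open>Q\<close>.
\<close>

lemma bessel_taylor_coefficients:
  assumes A: "A holomorphic_on ball 0 1" and r: "0 < r" "r < 1"
  shows "(\<Sum>k\<le>N. (cmod ((deriv ^^ k) A 0 / fact k) * r ^ k)\<^sup>2)
      \<le> (LINT t|unit_interval. (cmod (A (of_real r * circ t)))\<^sup>2)"
proof -
  define a where "a = (\<lambda>k. (deriv ^^ k) A 0 / fact k)"
  define S where "S = (\<lambda>z. \<Sum>k\<le>N. a k * z ^ k)"
  have holS: "S holomorphic_on ball 0 1" unfolding S_def by (intro holomorphic_intros)
  have coefS: "(deriv ^^ k) S 0 / fact k = a k" if "k \<le> N" for k
  proof -
    have "(\<lambda>n. (if n \<in> {..N} then a n * z ^ n else 0)) sums S z" for z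
      unfolding S_def by (rule sums_If_finite_set) simp
    then have "(\<lambda>n. (if n \<le> N then a n else 0) * z ^ n) sums S z" for z
      by (simp add: if_distrib[where f = "\<lambda>x. x * _"] cong: if_cong)
    then show ?thesis using that power_series_coefficient[of "\<lambda>n. if n \<le> N then a n else 0" S k] by simp
  qed
  have cont: "continuous_on {0..1} (\<lambda>t. G (of_real r * circ t))" if "G holomorphic_on ball 0 1" for G
    using r by (intro continuous_on_compose2[OF holomorphic_on_imp_continuous_on[OF that]] continuous_intros)
      (auto simp: norm_mult)
  define Q where "Q = (\<Sum>k\<le>N. (cmod (a k) * r ^ k)\<^sup>2)"
  have pair: "(LINT t|unit_interval. G (of_real r * circ t) * cnj (S (of_real r * circ t))) = of_real Q"
    if G: "G holomorphic_on ball 0 1" and co: "\<And>k. k \<le> N \<Longrightarrow> (deriv ^^ k) G 0 / fact k = a k" for G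
  proof -
    have "(LINT t|unit_interval. G (of_real r * circ t) * cnj (S (of_real r * circ t)))
       = (LINT t|unit_interval. (\<Sum>k\<le>N. cnj (a k) * of_real (r ^ k) * (G (of_real r * circ t) * cnj (circ t) ^ k)))"
      by (simp add: S_def sum_distrib_left power_mult_distrib mult_ac)
    also have "\<dots> = (\<Sum>k\<le>N. cnj (a k) * of_real (r ^ k) * (LINT t|unit_interval. G (of_real r * circ t) * cnj (circ t) ^ k))"
      by (subst Bochner_Integration.integral_sum)
         (auto intro!: continuous_unit_interval_integral continuous_intros cont G)
    also have "\<dots> = (\<Sum>k\<le>N. cnj (a k) * of_real (r ^ k) * (of_real (r ^ k) * a k))"
      by (intro sum.cong refl) (simp add: taylor_coefficient_circle_mean[OF G r] co)
    also have "\<dots> = of_real Q"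
      unfolding Q_def of_real_sum
    proof (intro sum.cong refl)
      fix k
      have "cnj (a k) * of_real (r ^ k) * (of_real (r ^ k) * a k) = (a k * cnj (a k)) * of_real ((r ^ k)\<^sup>2)"
        by (simp add: power2_eq_square mult_ac)
      also have "\<dots> = of_real ((cmod (a k))\<^sup>2) * of_real ((r ^ k)\<^sup>2)"
        by (simp only: complex_norm_square)
      finally show "cnj (a k) * of_real (r ^ k) * (of_real (r ^ k) * a k) = of_real ((cmod (a k) * r ^ k)\<^sup>2)"
        by (simp add: power_mult_distrib)
    qed
    finally show ?thesis .
  qed
  define g where "g = (\<lambda>t. A (of_real r * circ t))"
  define s where "s = (\<lambda>t. S (of_real r * circ t))"
  have cg: "continuous_on {0..1} g" and cs: "continuous_on {0..1} s"
    unfolding g_def s_def by (intro cont A holS)+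
  have "(LINT t|unit_interval. g t * cnj (s t)) = of_real Q"
    unfolding g_def s_def by (rule pair[OF A]) (simp add: a_def)
  then have 1: "(LINT t|unit_interval. Re (g t * cnj (s t))) = Q"
    by (subst integral_Re) (auto intro!: continuous_unit_interval_integral continuous_intros cg cs)
  have "(LINT t|unit_interval. s t * cnj (s t)) = of_real Q"
    unfolding s_def by (rule pair[OF holS coefS])
  then have 2: "(LINT t|unit_interval. Re (s t * cnj (s t))) = Q"
    by (subst integral_Re) (auto intro!: continuous_unit_interval_integral continuous_intros cs)
  have "0 \<le> (LINT t|unit_interval. (cmod (g t - s t))\<^sup>2)" by simp
  also have "\<dots> = (LINT t|unit_interval. (cmod (g t))\<^sup>2 - 2 * Re (g t * cnj (s t)) + Re (s t * cnj (s t)))"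
    by (intro Bochner_Integration.integral_cong refl, simp only: cmod_power2) (simp add: power2_eq_square algebra_simps)
  also have "\<dots> = (LINT t|unit_interval. (cmod (g t))\<^sup>2) - 2 * (LINT t|unit_interval. Re (g t * cnj (s t)))
        + (LINT t|unit_interval. Re (s t * cnj (s t)))"
    by (simp add: continuous_unit_interval_integral continuous_intros cg cs)
  finally show ?thesis unfolding 1 2 by (simp add: Q_def a_def g_def)
qed


section \<open>Removing zeros with Blaschke factors\<close>

lemma blaschke_factor_bounds:
  assumes "cmod a < 1" "cmod z \<le> 1"
  shows "cmod (z - a) \<le> cmod (1 - cnj a * z)"
    and "cmod z = 1 \<Longrightarrow> cmod (z - a) = cmod (1 - cnj a * z)"
    and "1 - cnj a * z \<noteq> 0"
proof -
  have id: "(cmod (1 - cnj a * z))\<^sup>2 - (cmod (z - a))\<^sup>2 = (1 - (cmod a)\<^sup>2) * (1 - (cmod z)\<^sup>2)"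
    unfolding cmod_power2 by (simp add: power2_eq_square algebra_simps)
  have "(cmod a)\<^sup>2 \<le> 1" "(cmod z)\<^sup>2 \<le> 1"
    using assms by (auto simp: power_le_one_iff)
  then have "0 \<le> (1 - (cmod a)\<^sup>2) * (1 - (cmod z)\<^sup>2)" by simp
  then have "(cmod (z - a))\<^sup>2 \<le> (cmod (1 - cnj a * z))\<^sup>2" using id by linarith
  then show "cmod (z - a) \<le> cmod (1 - cnj a * z)" by (simp add: power2_le_iff_abs_le)
  show "cmod (z - a) = cmod (1 - cnj a * z)" if "cmod z = 1"
    using id that by (simp add: power2_eq_iff_nonneg)
  show "1 - cnj a * z \<noteq> 0"
  proof
    assume "1 - cnj a * z = 0"
    then have "cmod (cnj a * z) = 1" by (metis eq_iff_diff_eq_0 norm_one)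
    moreover have "cmod a * cmod z \<le> cmod a * 1" by (rule mult_left_mono) (use assms in auto)
    ultimately show False using assms by (simp add: norm_mult)
  qed
qed

text \<open>
  The quotient \<open>F / (w - a)\<^sup>m\<close> is the local factor of \<open>F\<close> near \<open>a\<close>, so its singularity at \<open>a\<close> is
  removable and the factorisation is global.
\<close>

lemma divide_out_zero:
  assumes F: "F holomorphic_on S" "open S" "connected S" "a \<in> S" and nz: "\<exists>w\<in>S. F w \<noteq> 0"
  obtains G m where "G holomorphic_on S" "G a \<noteq> 0" "\<And>w. w \<in> S \<Longrightarrow> F w = (w - a) ^ m * G w"
proof -
  obtain r where r: "r > 0" "cball a r \<subseteq> S" "zor_poly F a holomorphic_on cball a r"
     "\<And>w. w \<in> cball a r \<Longrightarrow> F w = zor_poly F a w * (w - a) ^ nat (zorder F a) \<and> zor_poly F a w \<noteq> 0"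
    using zorder_exist_zero[OF F nz] by blast
  define g where "g = zor_poly F a"
  define m where "m = nat (zorder F a)"
  define G where "G = (\<lambda>w. if w = a then g a else F w / (w - a) ^ m)"
  have eq: "F w = (w - a) ^ m * G w" if "w \<in> S" for w
    using r(4)[of a] r(1) by (cases "w = a") (auto simp: G_def g_def m_def)
  have loc: "F w / (w - a) ^ m = g w" if "w \<in> ball a r - {a}" for w
    using r(4)[of w] that by (auto simp: g_def m_def)
  moreover have "g \<midarrow>a\<rightarrow> g a"
  proof -
    have "continuous_on (ball a r) g"
      unfolding g_def by (rule continuous_on_subset[OF holomorphic_on_imp_continuous_on[OF r(3)] ball_subset_cball])
    then have "isCont g a" using r(1) by (simp add: continuous_on_eq_continuous_at)
    then show ?thesis by (simp add: isCont_def)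
  qed
  ultimately have lim: "(\<lambda>w. F w / (w - a) ^ m) \<midarrow>a\<rightarrow> g a"
    using Lim_transform_within_open[of g "g a" a UNIV "ball a r" "\<lambda>w. F w / (w - a) ^ m"] r(1)
    by (metis Diff_iff centre_in_ball open_ball singletonD)
  have "(\<lambda>w. F w / (w - a) ^ m) holomorphic_on S - {a}"
    by (intro holomorphic_intros holomorphic_on_subset[OF F(1)]) auto
  then have "G holomorphic_on S"
    unfolding G_def by (rule removable_singularity[OF _ F(2) lim])
  moreover have "G a \<noteq> 0" using r(1) r(4)[of a] by (auto simp: G_def g_def)
  ultimately show ?thesis using eq that by blast
qed

text \<open>
  Induction on the number of distinct zeros in the closed disc, removing each with its full
  multiplicity: a Blaschke factor has modulus \<open>1\<close> on the circle and at most \<open>1\<close> inside. Only \<open>B\<close> carries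
  denominators, so the domain of \<open>G\<close> does not shrink.
\<close>

lemma blaschke_division:
  assumes "F holomorphic_on ball 0 \<rho>" "\<rho> > 1" "\<And>z. cmod z = 1 \<Longrightarrow> F z \<noteq> 0"
  shows "\<exists>B G. B holomorphic_on cball 0 1 \<and> G holomorphic_on ball 0 \<rho> \<and>
     (\<forall>z\<in>cball 0 1. F z = B z * G z \<and> G z \<noteq> 0 \<and> cmod (B z) \<le> 1) \<and> (\<forall>z. cmod z = 1 \<longrightarrow> cmod (G z) = cmod (F z))"
proof -
  have fin: "finite {z \<in> cball 0 1. F z = 0}" if "F holomorphic_on ball 0 \<rho>" "\<And>z. cmod z = 1 \<Longrightarrow> F z \<noteq> 0" for F
  proof (cases "F constant_on ball 0 \<rho>")
    case True
    then obtain c where "\<And>z. z \<in> ball 0 \<rho> \<Longrightarrow> F z = c" by (auto simp: constant_on_def)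
    moreover have "F 1 \<noteq> 0" using that(2) by simp
    ultimately have "{z \<in> cball 0 1. F z = 0} = {}" using assms(2) by auto
    then show ?thesis by (simp only: finite.emptyI)
  next
    case False
    moreover have "cball (0 :: complex) 1 \<subseteq> ball 0 \<rho>" using assms(2) by auto
    ultimately show ?thesis
      using holomorphic_compact_finite_zeros[OF that(1) open_ball connected_ball compact_cball] by blast
  qed
  show ?thesis
    using assms
  proof (induction "card {z \<in> cball 0 1. F z = 0}" arbitrary: F)
    case 0
    have "{z \<in> cball 0 1. F z = 0} = {}"
      using 0(1) card_0_eq[OF fin[OF 0(2,4)]] by simp
    then have "F z \<noteq> 0" if "z \<in> cball 0 1" for z using that by blast
    then show ?case
      by - (rule exI[of _ "\<lambda>_. 1"], rule exI[of _ F], use 0(2) in auto)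
  next
    case (Suc n)
    have "{z \<in> cball 0 1. F z = 0} \<noteq> {}" using Suc.hyps(2) by (metis card.empty nat.distinct(1))
    then obtain a where a: "cmod a \<le> 1" "F a = 0" by auto
    have "cmod a \<noteq> 1" using Suc.prems(3) a(2) by blast
    then have a1: "cmod a < 1" using a(1) by simp
    have "\<exists>w\<in>ball 0 \<rho>. F w \<noteq> 0" using Suc.prems(2) Suc.prems(3)[of 1] by (intro bexI[of _ 1]) auto
    then obtain F1 m where F1: "F1 holomorphic_on ball 0 \<rho>" "F1 a \<noteq> 0" "\<And>w. w \<in> ball 0 \<rho> \<Longrightarrow> F w = (w - a) ^ m * F1 w"
      using divide_out_zero[OF Suc.prems(1), of a] a1 Suc.prems(2) by auto
    define F2 where "F2 = (\<lambda>z. (1 - cnj a * z) ^ m * F1 z)"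
    define b where "b = (\<lambda>z. ((z - a) / (1 - cnj a * z)) ^ m)"
    note bl = blaschke_factor_bounds[OF a1]
    have hol2: "F2 holomorphic_on ball 0 \<rho>" unfolding F2_def by (intro holomorphic_intros F1)
    have Fb: "F z = b z * F2 z" if "cmod z \<le> 1" for z
      using F1(3)[of z] that Suc.prems(2) bl(3)[OF that] by (simp add: F2_def b_def power_divide)
    have nb: "cmod (b z) \<le> 1" if "cmod z \<le> 1" for z
      using bl[OF that] unfolding b_def norm_power norm_divide by (intro power_le_one) (auto simp: divide_le_eq)
    have nb1: "cmod (b z) = 1" if "cmod z = 1" for z
      using bl[of z] that unfolding b_def norm_power norm_divide by simp
    have "m > 0" using a F1(2) F1(3)[of a] Suc.prems(2) by (cases m) auto
    have z2: "{z \<in> cball 0 1. F2 z = 0} = {z \<in> cball 0 1. F z = 0} - {a}"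
    proof -
      have "F2 a \<noteq> 0" using F1(2) bl(3)[of a] a1 by (simp add: F2_def)
      moreover have "F z = 0 \<longleftrightarrow> F2 z = 0" if "cmod z \<le> 1" "z \<noteq> a" for z
        using Fb[OF that(1)] that bl(3)[of z] by (simp add: b_def)
      ultimately show ?thesis using a by auto
    qed
    have "n = card {z \<in> cball 0 1. F2 z = 0}"
      unfolding z2 using Suc.hyps(2) a fin[OF Suc.prems(1,3)] by (subst card_Diff_singleton) auto
    moreover have "F2 z \<noteq> 0" if "cmod z = 1" for z
      using Fb[of z] Suc.prems(3)[OF that] that by auto
    ultimately obtain B G where BG: "B holomorphic_on cball 0 1" "G holomorphic_on ball 0 \<rho>"
      "\<And>z. z\<in>cball 0 1 \<Longrightarrow> F2 z = B z * G z \<and> G z \<noteq> 0 \<and> cmod (B z) \<le> 1" "\<And>z. cmod z = 1 \<Longrightarrow> cmod (G z) = cmod (F2 z)"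
      using Suc.hyps(1)[of F2] hol2 Suc.prems(2) by blast
    show ?case
    proof (rule exI[of _ "\<lambda>z. b z * B z"], rule exI[of _ G], intro conjI ballI allI impI)
      show "(\<lambda>z. b z * B z) holomorphic_on cball 0 1"
        unfolding b_def using bl(3) by (intro holomorphic_intros BG) auto
      fix z :: complex
      assume z: "z \<in> cball 0 1"
      show "F z = b z * B z * G z" using Fb[of z] BG(3)[OF z] z by simp
      show "G z \<noteq> 0" using BG(3)[OF z] by simp
      show "cmod (b z * B z) \<le> 1"
        unfolding norm_mult using nb[of z] BG(3)[OF z] z by (intro mult_le_one) auto
    next
      fix z :: complex
      assume "cmod z = 1"
      then show "cmod (G z) = cmod (F z)" using BG(4)[of z] Fb[of z] nb1[of z] by (simp add: norm_mult)
    qed (rule BG)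
  qed
qed

text \<open>
  The zero-free factor of \<open>blaschke_division\<close> has no zeros on a slightly larger disc, by compactness,
  and therefore has a holomorphic \<open>k\<close>-th root there.
\<close>

lemma blaschke_root_factorization:
  assumes F: "F holomorphic_on ball 0 \<rho>" "\<rho> > 1" "\<And>z. cmod z = 1 \<Longrightarrow> F z \<noteq> 0" and k: "k > 0"
  obtains B H R where "B holomorphic_on ball 0 1" "R > 1" "H holomorphic_on ball 0 R"
    "\<And>z. z \<in> ball 0 1 \<Longrightarrow> F z = B z * H z ^ k" "\<And>z. z \<in> ball 0 1 \<Longrightarrow> cmod (B z) \<le> 1"
    "\<And>z. cmod z = 1 \<Longrightarrow> cmod (H z) ^ k = cmod (F z)"
proof -
  obtain B G where BG: "B holomorphic_on cball 0 1" "G holomorphic_on ball 0 \<rho>"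
      "\<And>z. z\<in>cball 0 1 \<Longrightarrow> F z = B z * G z \<and> G z \<noteq> 0 \<and> cmod (B z) \<le> 1" "\<And>z. cmod z = 1 \<Longrightarrow> cmod (G z) = cmod (F z)"
    using blaschke_division[OF F] by blast
  have "open {z \<in> ball 0 \<rho>. G z \<noteq> 0}"
  proof -
    have "open (ball 0 \<rho> \<inter> G -` (- {0}))"
      by (intro continuous_open_preimage holomorphic_on_imp_continuous_on BG) auto
    also have "ball 0 \<rho> \<inter> G -` (- {0}) = {z \<in> ball 0 \<rho>. G z \<noteq> 0}" by auto
    finally show ?thesis .
  qed
  moreover have "cball 0 1 \<subseteq> {z \<in> ball 0 \<rho>. G z \<noteq> 0}" using BG(3) F(2) by auto
  ultimately obtain e where e: "e > 0" "(\<Union>x\<in>cball 0 1. ball x e) \<subseteq> {z \<in> ball 0 \<rho>. G z \<noteq> 0}"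
    using compact_subset_open_imp_ball_epsilon_subset[of "cball 0 1" "{z \<in> ball 0 \<rho>. G z \<noteq> 0}"] compact_cball by blast
  have sub: "ball 0 (1 + e) \<subseteq> {z \<in> ball 0 \<rho>. G z \<noteq> 0}"
  proof
    fix z :: complex assume z: "z \<in> ball 0 (1 + e)"
    have "\<exists>x\<in>cball 0 1. z \<in> ball x e"
    proof (cases "cmod z \<le> 1")
      case True then show ?thesis using e by (intro bexI[of _ z]) auto
    next
      case False
      then have "z \<noteq> 0" by auto
      \<comment> \<open>The radial projection to the unit circle is within \<open>e\<close> of \<open>z\<close>.\<close>
      then have "z - sgn z = of_real (cmod z - 1) * sgn z"
        by (simp add: sgn_div_norm scaleR_conv_of_real algebra_simps field_simps)
      then have "cmod (z - sgn z) = \<bar>cmod z - 1\<bar>" using \<open>z \<noteq> 0\<close>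
        by (simp only: norm_mult norm_sgn norm_of_real) simp
      then have "cmod (z - sgn z) = cmod z - 1" using False by simp
      then show ?thesis using z by (intro bexI[of _ "sgn z"]) (auto simp: dist_norm norm_sgn norm_minus_commute)
    qed
    then show "z \<in> {z \<in> ball 0 \<rho>. G z \<noteq> 0}" using e(2) by blast
  qed
  have subG: "G holomorphic_on ball 0 (1 + e)"
    by (rule holomorphic_on_subset[OF BG(2)]) (use sub in blast)
  obtain g where g: "g holomorphic_on ball 0 (1 + e)" "\<And>z. z \<in> ball 0 (1 + e) \<Longrightarrow> exp (g z) = G z"
    by (rule holomorphic_logarithm_exists[of "ball 0 (1 + e)" G 0])
       (use sub subG e in auto)
  define H where "H = (\<lambda>z. exp (g z / of_nat k))"
  have HG: "H z ^ k = G z" if "cmod z \<le> 1" for z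
    using g(2)[of z] that e k by (simp add: H_def flip: exp_of_nat_mult)
  show ?thesis
  proof
    show "B holomorphic_on ball 0 1" by (rule holomorphic_on_subset[OF BG(1)]) auto
    show "1 + e > 1" using e by simp
    show "H holomorphic_on ball 0 (1 + e)" unfolding H_def using k by (intro holomorphic_intros g) auto
    show "F z = B z * H z ^ k" "cmod (B z) \<le> 1" if "z \<in> ball 0 1" for z using that HG[of z] BG(3)[of z] by auto
    show "cmod (H z) ^ k = cmod (F z)" if "cmod z = 1" for z
      using HG[of z] BG(4)[of z] that by (simp flip: norm_power)
  qed
qed

section \<open>The Poisson kernel\<close>

text \<open>
  Cauchy's formula at \<open>z\<close> for \<open>H(w) (1 - |z|\<^sup>2) / (1 - cnj z w)\<close>, which agrees with \<open>H\<close> at \<open>z\<close>. On the unit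
  circle \<open>w / ((1 - cnj z w) (w - z)) = 1 / |w - z|\<^sup>2\<close>.
\<close>

lemma poisson_formula:
  assumes H: "H holomorphic_on ball 0 R" "R > 1" and z: "cmod z < 1"
  shows "(LINT t|unit_interval. H (circ t) * of_real ((1 - (cmod z)\<^sup>2) / (cmod (circ t - z))\<^sup>2)) = H z"
proof -
  define G where "G = (\<lambda>w. H w * of_real (1 - (cmod z)\<^sup>2) / (1 - cnj z * w))"
  have ne: "1 - cnj z * w \<noteq> 0" if "cmod w \<le> 1" for w
    by (rule blaschke_factor_bounds(3)[OF z that])
  have holG: "G holomorphic_on cball 0 1"
    unfolding G_def using H(2) ne by (intro holomorphic_intros holomorphic_on_subset[OF H(1)]) auto
  have contG: "continuous_on (cball 0 1) G" by (rule holomorphic_on_imp_continuous_on[OF holG])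
  have nz: "w - z \<noteq> 0" if "cmod w = 1" for w using that z by auto
  have "((\<lambda>u. G u / (u - z)) has_contour_integral (2 * of_real pi * \<i> * G z)) (circlepath 0 1)"
    using Cauchy_has_contour_integral_higher_derivative_circlepath[OF contG holomorphic_on_subset[OF holG], of z 0] z
    by (simp add: ball_subset_cball)
  then have "(LINT t|unit_interval. G (of_real 1 * circ t) / (of_real 1 * circ t - z) * (of_real 1 * circ t)) = G z"
    by (rule has_contour_integral_circle_mean)
       (use nz in \<open>auto intro!: continuous_intros continuous_on_subset[OF contG]\<close>)
  moreover have "G (circ t) / (circ t - z) * circ t = H (circ t) * of_real ((1 - (cmod z)\<^sup>2) / (cmod (circ t - z))\<^sup>2)" for t
  proof -
    have "(of_real ((cmod (circ t - z))\<^sup>2) :: complex) = (circ t - z) * cnj (circ t - z)"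
      by (rule complex_norm_square)
    then have "(of_real ((cmod (circ t - z))\<^sup>2) :: complex) * circ t = (circ t - z) * cnj (circ t - z) * circ t"
      by (rule arg_cong)
    also have "\<dots> = (circ t - z) * (circ t * cnj (circ t) - cnj z * circ t)"
      by (simp add: algebra_simps)
    finally have e: "(of_real ((cmod (circ t - z))\<^sup>2) :: complex) * circ t = (circ t - z) * (1 - cnj z * circ t)"
      by (simp add: circ_cnj)
    have n: "circ t - z \<noteq> 0" "1 - cnj z * circ t \<noteq> 0" using nz ne by auto
    have n2: "(of_real ((cmod (circ t - z))\<^sup>2) :: complex) \<noteq> 0" using n by simp
    have q: "circ t / ((circ t - z) * (1 - cnj z * circ t)) = 1 / of_real ((cmod (circ t - z))\<^sup>2)"
      using n n2 unfolding e[symmetric] by simp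
    have "G (circ t) / (circ t - z) * circ t =
        H (circ t) * of_real (1 - (cmod z)\<^sup>2) * (circ t / ((circ t - z) * (1 - cnj z * circ t)))"
      by (simp add: G_def mult_ac)
    also have "\<dots> = H (circ t) * of_real ((1 - (cmod z)\<^sup>2) / (cmod (circ t - z))\<^sup>2)"
      unfolding q by (simp only: of_real_divide times_divide_eq_right mult_1_right mult.assoc)
    finally show ?thesis .
  qed
  moreover have "G z = H z"
  proof -
    have "(1 - cnj z * z) = of_real (1 - (cmod z)\<^sup>2)"
      by (simp add: complex_norm_square mult.commute del: of_real_power)
    moreover have "1 - cnj z * z \<noteq> 0" using ne z by auto
    ultimately show ?thesis by (simp add: G_def)
  qed
  ultimately show ?thesis by simp
qed

definition poisson :: "real \<Rightarrow> real \<Rightarrow> real \<Rightarrow> real" where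
  "poisson r x y = (1 - r\<^sup>2) / (cmod (circ y - of_real r * circ x))\<^sup>2"

lemma poisson_symmetric: "poisson r x y = poisson r y x"
proof -
  have "cmod (circ y - of_real r * circ x) = cmod (circ x - of_real r * circ y)"
  proof -
    have "circ y - of_real r * circ x = circ x * circ y * cnj (circ x - of_real r * circ y)"
      using circ_cnj[of x] circ_cnj[of y] by (simp add: algebra_simps)
    then show ?thesis by (simp only: norm_mult norm_circ complex_mod_cnj mult_1)
  qed
  then show ?thesis by (simp add: poisson_def)
qed

lemma poisson_denominator_ge:
  assumes "0 \<le> r" "r < 1"
  shows "1 - r \<le> cmod (circ y - of_real r * circ x)"
  using norm_triangle_ineq2[of "circ y" "of_real r * circ x"] assms by (simp add: norm_mult)

lemma poisson_bounds:
  assumes "0 \<le> r" "r < 1"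
  shows "0 \<le> poisson r x y" "poisson r x y \<le> 2 / (1 - r)"
proof -
  have "r\<^sup>2 \<le> 1" using assms by (simp add: power_le_one_iff)
  then show "0 \<le> poisson r x y" by (simp add: poisson_def)
  have "poisson r x y \<le> (1 - r\<^sup>2) / (1 - r)\<^sup>2"
    unfolding poisson_def using assms \<open>r\<^sup>2 \<le> 1\<close> poisson_denominator_ge[OF assms, of y x]
    by (intro divide_left_mono power_mono mult_pos_pos zero_less_power) auto
  also have "\<dots> = (1 + r) / (1 - r)"
  proof -
    have "1 - r\<^sup>2 = (1 + r) * (1 - r)" by (simp add: power2_eq_square algebra_simps)
    then show ?thesis using assms by (simp add: power2_eq_square)
  qed
  also have "\<dots> \<le> 2 / (1 - r)" using assms by (intro divide_right_mono) auto
  finally show "poisson r x y \<le> 2 / (1 - r)" .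
qed

lemma continuous_on_poisson:
  assumes "0 \<le> r" "r < 1"
  shows "continuous_on A (\<lambda>(x, y). poisson r x y)"
proof -
  have "cmod (circ y - of_real r * circ x) \<noteq> 0" for x y
    using poisson_denominator_ge[OF assms, of y x] assms by linarith
  then show ?thesis
    unfolding poisson_def circ_def case_prod_beta by (intro continuous_intros) (auto simp: circ_def)
qed

text \<open>
  Poisson's formula for the constant function \<open>1\<close>.
\<close>

lemma poisson_mean:
  assumes "0 \<le> r" "r < 1"
  shows "(LINT y|unit_interval. poisson r x y) = 1"
proof -
  have "(LINT y|unit_interval. complex_of_real (poisson r x y)) = 1"
    using poisson_formula[of "\<lambda>_. 1" 2 "of_real r * circ x"] assms
    by (simp add: poisson_def norm_mult)
  then show ?thesis by (metis integral_complex_of_real of_real_eq_1_iff)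
qed

lemma norm_le_poisson_mean:
  assumes H: "H holomorphic_on ball 0 R" "R > 1" and r: "0 \<le> r" "r < 1"
  shows "cmod (H (of_real r * circ x)) \<le> (LINT y|unit_interval. poisson r x y * cmod (H (circ y)))"
proof -
  have "H (of_real r * circ x) = (LINT y|unit_interval. H (circ y) * of_real (poisson r x y))"
    using poisson_formula[OF H, of "of_real r * circ x"] r by (simp add: poisson_def norm_mult)
  also have "cmod \<dots> \<le> (LINT y|unit_interval. cmod (H (circ y) * of_real (poisson r x y)))"
    by (rule integral_norm_bound)
  also have "\<dots> = (LINT y|unit_interval. poisson r x y * cmod (H (circ y)))"
    using poisson_bounds(1)[OF r] by (simp add: norm_mult mult.commute)
  finally show ?thesis .
qed

section \<open>Hardy's inequality on a circle\<close>

text \<open>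
  The coefficients of \<open>F\<close> are the Cauchy product of those of \<open>B H\<^sup>2\<close> and \<open>H\<^sup>2\<close>, and both factors have mean
  square at most the mean of \<open>|H|\<^sup>4\<close>. Hilbert's inequality for the Cauchy product and Bessel's inequality
  for the two factors give the bound.
\<close>

lemma hardy_inequality_factored:
  assumes B: "B holomorphic_on ball 0 1" "\<And>z. z \<in> ball 0 1 \<Longrightarrow> cmod (B z) \<le> 1"
    and H: "H holomorphic_on ball 0 1" and F: "\<And>z. z \<in> ball 0 1 \<Longrightarrow> F z = B z * H z ^ 4"
    and r: "0 < r" "r < 1"
  shows "(\<Sum>n\<le>N. cmod ((deriv ^^ n) F 0 / fact n) * r ^ n / real (n + 2))
     \<le> pi * (LINT t|unit_interval. cmod (H (of_real r * circ t)) ^ 4)"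
proof -
  define A where "A = (\<lambda>z. B z * H z ^ 2)"
  define D where "D = (\<lambda>z. H z ^ 2)"
  have holA: "A holomorphic_on ball 0 1" and holD: "D holomorphic_on ball 0 1"
    unfolding A_def D_def by (intro holomorphic_intros B H)+
  define coef where "coef = (\<lambda>G :: complex \<Rightarrow> complex. \<lambda>n. (deriv ^^ n) G 0 / fact n)"
  have conv: "coef F n = (\<Sum>k\<le>n. coef A k * coef D (n - k))" for n
  proof -
    have "\<forall>\<^sub>F z in nhds 0. z \<in> ball (0 :: complex) 1"
      by (rule eventually_nhds_in_open) auto
    then have "\<forall>\<^sub>F z in nhds 0. F z = A z * D z"
      by eventually_elim (simp add: F A_def D_def power2_eq_square power4_eq_xxxx mult_ac)
    then have "(deriv ^^ n) F 0 = (deriv ^^ n) (\<lambda>z. A z * D z) 0"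
      by (rule higher_deriv_cong_ev) simp
    also have "\<dots> = (\<Sum>i = 0..n. of_nat (n choose i) * (deriv ^^ i) A 0 * (deriv ^^ (n - i)) D 0)"
      by (rule higher_deriv_mult[OF holA holD]) auto
    finally have "coef F n = (\<Sum>i\<le>n. of_nat (n choose i) * (deriv ^^ i) A 0 * (deriv ^^ (n - i)) D 0 / fact n)"
      by (simp add: coef_def sum_divide_distrib atMost_atLeast0)
    also have "\<dots> = (\<Sum>k\<le>n. coef A k * coef D (n - k))"
      by (intro sum.cong refl) (simp add: coef_def binomial_fact)
    finally show ?thesis .
  qed
  have "(\<Sum>n\<le>N. cmod (coef F n) * r ^ n / real (n + 2)) \<le>
     pi / 2 * ((\<Sum>k\<le>N. (cmod (coef A k) * r ^ k)\<^sup>2) + (\<Sum>l\<le>N. (cmod (coef D l) * r ^ l)\<^sup>2))"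
  proof (rule cauchy_product_hilbert)
    fix n
    have "cmod (coef F n) * r ^ n \<le> (\<Sum>k\<le>n. cmod (coef A k) * cmod (coef D (n - k))) * r ^ n"
      unfolding conv using r by (intro mult_right_mono sum_norm_le) (auto simp: norm_mult)
    also have "\<dots> = (\<Sum>k\<le>n. cmod (coef A k) * r ^ k * (cmod (coef D (n - k)) * r ^ (n - k)))"
      unfolding sum_distrib_right
    proof (intro sum.cong refl)
      fix k assume "k \<in> {..n}"
      then have "r ^ n = r ^ k * r ^ (n - k)" by (simp flip: power_add)
      then show "cmod (coef A k) * cmod (coef D (n - k)) * r ^ n = cmod (coef A k) * r ^ k * (cmod (coef D (n - k)) * r ^ (n - k))"
        by simp
    qed
    finally show "cmod (coef F n) * r ^ n \<le> (\<Sum>k\<le>n. cmod (coef A k) * r ^ k * (cmod (coef D (n - k)) * r ^ (n - k)))" .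
  qed (use r in auto)
  also have "\<dots> \<le> pi / 2 * ((LINT t|unit_interval. cmod (H (of_real r * circ t)) ^ 4) + (LINT t|unit_interval. cmod (H (of_real r * circ t)) ^ 4))"
  proof (intro mult_left_mono add_mono)
    have cont: "continuous_on {0..1} (\<lambda>t. G (of_real r * circ t))" if "G holomorphic_on ball 0 1" for G
      using r by (intro continuous_on_compose2[OF holomorphic_on_imp_continuous_on[OF that]] continuous_intros)
        (auto simp: norm_mult)
    have bound: "(\<Sum>k\<le>N. (cmod (coef G k) * r ^ k)\<^sup>2) \<le> (LINT t|unit_interval. cmod (H (of_real r * circ t)) ^ 4)"
      if hol: "G holomorphic_on ball 0 1" and le: "\<And>z. z \<in> ball 0 1 \<Longrightarrow> cmod (G z) \<le> cmod (H z) ^ 2" for G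
    proof -
      have "(\<Sum>k\<le>N. (cmod (coef G k) * r ^ k)\<^sup>2) \<le> (LINT t|unit_interval. (cmod (G (of_real r * circ t)))\<^sup>2)"
        unfolding coef_def by (rule bessel_taylor_coefficients[OF hol r])
      also have "\<dots> \<le> (LINT t|unit_interval. cmod (H (of_real r * circ t)) ^ 4)"
      proof (rule integral_mono)
        fix t
        have "(cmod (G (of_real r * circ t)))\<^sup>2 \<le> (cmod (H (of_real r * circ t)) ^ 2)\<^sup>2"
          using r by (intro power_mono le) (auto simp: norm_mult)
        then show "(cmod (G (of_real r * circ t)))\<^sup>2 \<le> cmod (H (of_real r * circ t)) ^ 4" by simp
      qed (auto intro!: continuous_unit_interval_integral continuous_intros cont hol H)
      finally show ?thesis .
    qed
    show "(\<Sum>k\<le>N. (cmod (coef A k) * r ^ k)\<^sup>2) \<le> (LINT t|unit_interval. cmod (H (of_real r * circ t)) ^ 4)"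
    proof (rule bound[OF holA])
      fix z :: complex assume "z \<in> ball 0 1"
      then have "cmod (B z) * cmod (H z) ^ 2 \<le> 1 * cmod (H z) ^ 2" by (intro mult_right_mono B) auto
      then show "cmod (A z) \<le> cmod (H z) ^ 2" by (simp add: A_def norm_mult norm_power)
    qed
    show "(\<Sum>k\<le>N. (cmod (coef D k) * r ^ k)\<^sup>2) \<le> (LINT t|unit_interval. cmod (H (of_real r * circ t)) ^ 4)"
      by (rule bound[OF holD]) (simp add: D_def norm_power)
  qed auto
  finally show ?thesis by (simp add: coef_def)
qed


section \<open>Growth functions\<close>

lemma growth_function_le_iff:
  assumes "growth_function \<Psi> p" "0 \<le> s" "0 \<le> t"
  shows "\<Psi> s \<le> \<Psi> t \<longleftrightarrow> s \<le> t"
  using assms strict_mono_on_less_eq[of "{0..}" \<Psi> s t] by (auto simp: growth_function_def)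

lemma growth_function_nonneg:
  assumes "growth_function \<Psi> p" "0 \<le> t"
  shows "0 \<le> \<Psi> t"
  using assms by (auto simp: growth_function_def Pi_def)

lemma growth_function_ratio_antimono:
  assumes "growth_function \<Psi> p" "0 < s" "s \<le> t"
  shows "\<Psi> t / t \<le> \<Psi> s / s"
  using assms monotone_onD[of "{0<..}" "(\<le>)" "(\<lambda>x y. y \<le> x)" "\<lambda>t. \<Psi> t / t" s t]
  by (auto simp: growth_function_def)

lemma growth_function_lower_type:
  assumes "growth_function \<Psi> p"
  obtains c where "c > 0" "\<And>s t. 0 < s \<Longrightarrow> s < t \<Longrightarrow> \<Psi> s \<le> c * (s / t) powr p * \<Psi> t"
proof -
  obtain c where c: "c > 0" "\<And>t s. t \<ge> 0 \<Longrightarrow> s \<in> {0<..<1} \<Longrightarrow> \<Psi> (s * t) \<le> c * s powr p * \<Psi> t"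
    using assms by (auto simp: growth_function_def)
  have "\<Psi> s \<le> c * (s / t) powr p * \<Psi> t" if "0 < s" "s < t" for s t
    using c(2)[of t "s / t"] that by simp
  then show ?thesis using c(1) that by blast
qed

text \<open>
  A growth function is a bijection of \<open>[0,\<infinity>)\<close> onto itself, by the intermediate value theorem.
\<close>

lemma growth_inv_props:
  assumes g: "growth_function \<Psi> p" and x: "0 \<le> x"
  shows "0 \<le> growth_inv \<Psi> x" "\<Psi> (growth_inv \<Psi> x) = x"
proof -
  have inj: "inj_on \<Psi> {0..}" using g by (auto simp: growth_function_def intro: strict_mono_on_imp_inj_on)
  have "\<forall>\<^sub>F t in at_top. \<Psi> t \<ge> x" using g by (auto simp: growth_function_def filterlim_at_top)
  then have "\<forall>\<^sub>F t in at_top. \<Psi> t \<ge> x \<and> t \<ge> 0" using eventually_ge_at_top[of 0] by eventually_elim auto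
  then obtain T where T: "\<Psi> T \<ge> x" "T \<ge> 0" using eventually_happens'[OF trivial_limit_at_top_linorder] by blast
  have "continuous_on {0..T} \<Psi>" using g by (auto simp: growth_function_def intro: continuous_on_subset)
  moreover have "\<Psi> 0 \<le> x" using g x by (auto simp: growth_function_def)
  ultimately obtain t where t: "0 \<le> t" "\<Psi> t = x" using IVT'[of \<Psi> 0 x T] T by auto
  then have "x \<in> \<Psi> ` {0..}" by auto
  then show "\<Psi> (growth_inv \<Psi> x) = x" "0 \<le> growth_inv \<Psi> x"
    using the_inv_into_into[OF inj, of x "{0..}"] f_the_inv_into_f[OF inj, of x] by (auto simp: growth_inv_def)
qed

lemma growth_inv_pos:
  assumes g: "growth_function \<Psi> p" and x: "0 < x"
  shows "0 < growth_inv \<Psi> x"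
proof -
  have "\<Psi> 0 = 0" using g by (simp add: growth_function_def)
  then have "growth_inv \<Psi> x \<noteq> 0" using growth_inv_props[OF g, of x] x by force
  then show ?thesis using growth_inv_props(1)[OF g, of x] x by linarith
qed

lemma growth_inv_ratio_antimono:
  assumes g: "growth_function \<Psi> p" and x: "0 < x" "x \<le> y"
  shows "y / growth_inv \<Psi> y \<le> x / growth_inv \<Psi> x"
proof -
  have "\<Psi> (growth_inv \<Psi> x) \<le> \<Psi> (growth_inv \<Psi> y)" using growth_inv_props(2)[OF g] x by simp
  then have "growth_inv \<Psi> x \<le> growth_inv \<Psi> y"
    using growth_function_le_iff[OF g] growth_inv_props(1)[OF g] x by simp
  from growth_function_ratio_antimono[OF g growth_inv_pos[OF g x(1)] this]
  show ?thesis using growth_inv_props(2)[OF g] x by simp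
qed


section \<open>Poisson integrals of bounded functions\<close>

lemma integrable_unit_interval_bounded:
  fixes f :: "real \<Rightarrow> real"
  assumes "f \<in> borel_measurable unit_interval" "\<And>x. x \<in> {0..1} \<Longrightarrow> \<bar>f x\<bar> \<le> C"
  shows "integrable unit_interval f"
  by (rule finite_measure.integrable_const_bound[OF finite_measure_unit_interval, of _ C])
     (use assms in \<open>auto intro: AE_I2\<close>)

definition poisson_integral :: "real \<Rightarrow> (real \<Rightarrow> real) \<Rightarrow> real \<Rightarrow> real" where
  "poisson_integral r f x = (LINT y|unit_interval. poisson r x y * f y)"

lemma poisson_measurable:
  assumes r: "0 \<le> r" "r < 1"
  shows "(\<lambda>(x, y). poisson r x y) \<in> borel_measurable (unit_interval \<Otimes>\<^sub>M unit_interval)"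
proof -
  have k: "(\<lambda>(x, y). poisson r x y) \<in> borel_measurable (borel \<Otimes>\<^sub>M borel)"
    unfolding borel_prod by (intro borel_measurable_continuous_onI continuous_on_poisson r)
  have id: "(\<lambda>x. x) \<in> unit_interval \<rightarrow>\<^sub>M (borel :: real measure)"
    by (rule borel_measurable_unit_intervalI) simp
  have "(\<lambda>z. (fst z, snd z)) \<in> unit_interval \<Otimes>\<^sub>M unit_interval \<rightarrow>\<^sub>M borel \<Otimes>\<^sub>M (borel :: real measure)"
    by (rule measurable_Pair[OF measurable_compose[OF measurable_fst id] measurable_compose[OF measurable_snd id]])
  from measurable_compose[OF this k] show ?thesis
    by (simp only: prod.collapse)
qed

context
  fixes r C :: real and f :: "real \<Rightarrow> real"
  assumes r: "0 \<le> r" "r < 1"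
    and f: "f \<in> borel_measurable unit_interval" "\<And>x. x \<in> {0..1} \<Longrightarrow> 0 \<le> f x" "\<And>x. x \<in> {0..1} \<Longrightarrow> f x \<le> C"
begin

lemma poisson_kernel_integrable: "integrable unit_interval (\<lambda>y. poisson r x y * f y)"
proof -
  have "continuous_on UNIV (\<lambda>y. poisson r x y)"
    using continuous_on_compose2[OF continuous_on_poisson[OF r, of UNIV], of UNIV "\<lambda>y. (x, y)"]
    by (simp add: continuous_on_Pair)
  then have m: "(\<lambda>y. poisson r x y) \<in> borel_measurable unit_interval"
    by (intro borel_measurable_unit_intervalI borel_measurable_continuous_onI)
  show ?thesis
  proof (rule integrable_unit_interval_bounded[where C = "2 / (1 - r) * C"])
    fix y :: real assume y: "y \<in> {0..1}"
    have "poisson r x y * f y \<le> 2 / (1 - r) * C"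
      using poisson_bounds[OF r, of x y] f(2,3)[OF y] r by (intro mult_mono) auto
    then show "\<bar>poisson r x y * f y\<bar> \<le> 2 / (1 - r) * C"
      using poisson_bounds(1)[OF r, of x y] f(2)[OF y] by simp
  qed (intro borel_measurable_times m f)
qed

lemma poisson_integral_nonneg: "0 \<le> poisson_integral r f x"
  unfolding poisson_integral_def using poisson_bounds(1)[OF r] f(2)
  by (intro Bochner_Integration.integral_nonneg) simp

lemma poisson_integral_le: "poisson_integral r f x \<le> 2 / (1 - r) * (LINT y|unit_interval. f y)"
proof -
  have "poisson_integral r f x \<le> (LINT y|unit_interval. 2 / (1 - r) * f y)"
    unfolding poisson_integral_def
  proof (rule integral_mono[OF poisson_kernel_integrable])
    show "integrable unit_interval (\<lambda>y. 2 / (1 - r) * f y)"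
      using f by (intro integrable_mult_right integrable_unit_interval_bounded[where C = C]) auto
    fix y assume "y \<in> space unit_interval"
    then show "poisson r x y * f y \<le> 2 / (1 - r) * f y"
      by (intro mult_right_mono poisson_bounds(2)[OF r] f(2)) simp
  qed
  then show ?thesis by simp
qed

text \<open>
  Fubini's theorem: by symmetry the kernel also has mean \<open>1\<close> in its first angle.
\<close>

lemma poisson_integral_mean:
  shows "integrable unit_interval (poisson_integral r f)"
    and "(LINT x|unit_interval. poisson_integral r f x) = (LINT y|unit_interval. f y)"
proof -
  interpret U: finite_measure unit_interval by (rule finite_measure_unit_interval)
  interpret P: pair_sigma_finite unit_interval unit_interval by unfold_locales
  interpret UU: finite_measure "unit_interval \<Otimes>\<^sub>M unit_interval"
    by (intro finite_measure_pair_measure finite_measure_unit_interval)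
  have fm: "(\<lambda>z. f (snd z)) \<in> borel_measurable (unit_interval \<Otimes>\<^sub>M unit_interval)"
    by (rule measurable_compose[OF measurable_snd f(1)])
  have int: "integrable (unit_interval \<Otimes>\<^sub>M unit_interval) (\<lambda>(x, y). poisson r x y * f y)"
  proof (rule UU.integrable_const_bound[where B = "2 / (1 - r) * C"])
    show "(\<lambda>(x, y). poisson r x y * f y) \<in> borel_measurable (unit_interval \<Otimes>\<^sub>M unit_interval)"
      using borel_measurable_times[OF poisson_measurable[OF r] fm] by (simp add: case_prod_beta')
    show "AE z in unit_interval \<Otimes>\<^sub>M unit_interval. norm (case z of (x, y) \<Rightarrow> poisson r x y * f y) \<le> 2 / (1 - r) * C"
    proof (rule AE_I2)
      fix z assume "z \<in> space (unit_interval \<Otimes>\<^sub>M unit_interval)"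
      then obtain x y where z: "z = (x, y)" "y \<in> {0..1}" by (auto simp: space_pair_measure)
      have "poisson r x y * f y \<le> 2 / (1 - r) * C"
        using poisson_bounds[OF r, of x y] f(2,3)[OF z(2)] r by (intro mult_mono) auto
      then show "norm (case z of (x, y) \<Rightarrow> poisson r x y * f y) \<le> 2 / (1 - r) * C"
        using poisson_bounds(1)[OF r, of x y] f(2)[OF z(2)] z by simp
    qed
  qed
  show "integrable unit_interval (poisson_integral r f)"
    unfolding poisson_integral_def using P.integrable_fst[OF int] by simp
  have "(LINT x|unit_interval. poisson_integral r f x) = (LINT y|unit_interval. LINT x|unit_interval. poisson r x y * f y)"
    unfolding poisson_integral_def using P.Fubini_integral[of "\<lambda>x y. poisson r x y * f y"] int by simp
  also have "\<dots> = (LINT y|unit_interval. f y)"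
  proof (intro Bochner_Integration.integral_cong refl)
    fix y
    have "(LINT x|unit_interval. poisson r x y * f y) = (LINT x|unit_interval. poisson r y x) * f y"
      unfolding poisson_symmetric[of r _ y] by (rule integral_mult_left_zero)
    then show "(LINT x|unit_interval. poisson r x y * f y) = f y"
      by (simp only: poisson_mean[OF r] mult_1)
  qed
  finally show "(LINT x|unit_interval. poisson_integral r f x) = (LINT y|unit_interval. f y)" .
qed

end

text \<open>
  Jensen's inequality for the fourth power, from its tangent line at the value \<open>m\<close> of the Poisson integral.
\<close>

lemma poisson_integral_power4_le:
  assumes r: "0 \<le> r" "r < 1"
    and f: "f \<in> borel_measurable unit_interval" "\<And>x. x \<in> {0..1} \<Longrightarrow> 0 \<le> f x" "\<And>x. x \<in> {0..1} \<Longrightarrow> f x \<le> C"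
  shows "poisson_integral r f x ^ 4 \<le> poisson_integral r (\<lambda>y. f y ^ 4) x"
proof -
  define m where "m = poisson_integral r f x"
  have m: "0 \<le> m" unfolding m_def by (rule poisson_integral_nonneg[OF r f])
  have tangent: "m ^ 4 + 4 * m ^ 3 * (a - m) \<le> a ^ 4" if "0 \<le> a" for a
  proof -
    have "0 \<le> (a - m)\<^sup>2 * (a\<^sup>2 + 2 * a * m + 3 * m\<^sup>2)" using that m by simp
    also have "\<dots> = a ^ 4 - (m ^ 4 + 4 * m ^ 3 * (a - m))"
      by (simp add: power2_eq_square power3_eq_cube power4_eq_xxxx algebra_simps)
    finally show ?thesis by simp
  qed
  have one: "(\<lambda>y. 1) \<in> borel_measurable unit_interval" by simp
  have i1: "integrable unit_interval (\<lambda>y. poisson r x y)"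
    using poisson_kernel_integrable[OF r one, of 1 x] by simp
  have i2: "integrable unit_interval (\<lambda>y. poisson r x y * f y)" by (rule poisson_kernel_integrable[OF r f])
  have i3: "integrable unit_interval (\<lambda>y. poisson r x y * f y ^ 4)"
    by (rule poisson_kernel_integrable[OF r, where C = "C ^ 4"]) (use f in \<open>auto intro: power_mono\<close>)
  have "(LINT y|unit_interval. (m ^ 4 - 4 * m ^ 3 * m) * poisson r x y + 4 * m ^ 3 * (poisson r x y * f y))
     \<le> (LINT y|unit_interval. poisson r x y * f y ^ 4)"
  proof (rule integral_mono)
    fix y assume "y \<in> space unit_interval"
    then have "poisson r x y * (m ^ 4 + 4 * m ^ 3 * (f y - m)) \<le> poisson r x y * f y ^ 4"
      using f(2) by (intro mult_left_mono tangent poisson_bounds(1)[OF r]) auto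
    then show "(m ^ 4 - 4 * m ^ 3 * m) * poisson r x y + 4 * m ^ 3 * (poisson r x y * f y) \<le> poisson r x y * f y ^ 4"
      by (simp add: algebra_simps)
  qed (intro Bochner_Integration.integrable_add integrable_mult_right i1 i2 i3)+
  also have "(LINT y|unit_interval. (m ^ 4 - 4 * m ^ 3 * m) * poisson r x y + 4 * m ^ 3 * (poisson r x y * f y))
     = (m ^ 4 - 4 * m ^ 3 * m) + 4 * m ^ 3 * m"
    using poisson_mean[OF r, of x]
    by (subst Bochner_Integration.integral_add) (simp_all add: i1 i2 m_def poisson_integral_def)
  finally show ?thesis by (simp add: m_def poisson_integral_def)
qed

section \<open>Weighted sums of Poisson integrals\<close>

lemma sum_powers_of_two_below:
  fixes Y :: real and J :: nat
  assumes "0 \<le> Y"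
  shows "(\<Sum>j\<le>J. if 2 ^ j < Y then 2 ^ j else 0) \<le> 2 * Y"
proof (induction J)
  case 0
  have "(\<Sum>j\<le>0::nat. if 2 ^ j < Y then 2 ^ j else 0) = (if 1 < Y then 1 else 0 :: real)" by simp
  also have "\<dots> \<le> 2 * Y" using assms by (cases "1 < Y") simp_all
  finally show ?case .
next
  case (Suc J)
  show ?case
  proof (cases "2 ^ Suc J < Y")
    case True
    have "(\<Sum>j\<le>Suc J. if 2 ^ j < Y then 2 ^ j else 0) \<le> (\<Sum>j\<le>Suc J. 2 ^ j :: real)"
      by (intro sum_mono) auto
    also have "\<dots> \<le> 2 ^ Suc (Suc J)"
    proof -
      have "(\<Sum>j\<le>n. 2 ^ j :: real) = 2 ^ Suc n - 1" for n :: nat by (induction n) auto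
      then show ?thesis by simp
    qed
    finally show ?thesis using True by simp
  next
    case False
    then show ?thesis using Suc by simp
  qed
qed

text \<open>
  Only the indices \<open>j \<ge> i\<close> contribute, where \<open>L i\<close> is the first level above \<open>t\<close>. Their weights sum to at
  most \<open>\<Psi>(L i) / L i\<close>, and \<open>\<Psi>(s)/s\<close> is non-increasing.
\<close>

lemma weighted_truncations_le:
  fixes L w :: "nat \<Rightarrow> real"
  assumes g: "growth_function \<Psi> p" and t: "0 \<le> t"
    and L: "\<And>j. 0 < L j" and w: "\<And>j. j \<le> J \<Longrightarrow> 0 \<le> w j"
    and tail: "\<And>i. i \<le> J \<Longrightarrow> (\<Sum>j\<in>{i..J}. w j) \<le> \<Psi> (L i) / L i"
  shows "(\<Sum>j\<le>J. w j * (if t \<le> L j then t else 0)) \<le> \<Psi> t"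
proof (cases "t > 0 \<and> (\<exists>i\<le>J. t \<le> L i)")
  case False
  then have "(\<Sum>j\<le>J. w j * (if t \<le> L j then t else 0)) = 0"
    using t by (intro sum.neutral) auto
  then show ?thesis using growth_function_nonneg[OF g t] by simp
next
  case True
  define i where "i = (LEAST i. i \<le> J \<and> t \<le> L i)"
  have i: "i \<le> J" "t \<le> L i" using LeastI_ex[of "\<lambda>i. i \<le> J \<and> t \<le> L i"] True by (auto simp: i_def)
  have small: "\<not> t \<le> L j" if "j < i" for j
    using not_less_Least[of j "\<lambda>i. i \<le> J \<and> t \<le> L i"] that i by (auto simp: i_def)
  have "(\<Sum>j\<le>J. w j * (if t \<le> L j then t else 0)) = (\<Sum>j\<in>{i..J}. w j * (if t \<le> L j then t else 0))"
  proof (rule sum.mono_neutral_right)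
    show "\<forall>j\<in>{..J} - {i..J}. w j * (if t \<le> L j then t else 0) = 0"
    proof
      fix j assume "j \<in> {..J} - {i..J}"
      then have "\<not> t \<le> L j" by (intro small) auto
      then show "w j * (if t \<le> L j then t else 0) = 0" by simp
    qed
  qed auto
  also have "\<dots> \<le> (\<Sum>j\<in>{i..J}. w j * t)"
    using t w by (intro sum_mono mult_left_mono) auto
  also have "\<dots> = (\<Sum>j\<in>{i..J}. w j) * t" by (simp add: sum_distrib_right)
  also have "\<dots> \<le> \<Psi> (L i) / L i * t" by (intro mult_right_mono tail i t)
  also have "\<dots> \<le> \<Psi> t / t * t"
    using True i by (intro mult_right_mono growth_function_ratio_antimono[OF g]) auto
  finally show ?thesis using True by simp
qed

text \<open>
  The cut at one level \<open>l\<close>. The part \<open>a\<close> below is handled by Jensen's inequality. The part \<open>b\<close> above is,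
  by the lower type condition, at most \<open>l\<^sup>1\<^sup>/\<^sup>4 sqrt c \<beta>\<close> with \<open>\<beta> = (\<Psi>(V\<^sup>4)/q)\<^sup>1\<^sup>/\<^sup>2\<close>. As \<open>\<beta> \<le> \<beta>\<^sup>2\<close> there, its
  Poisson integral is uniformly at most a constant times \<open>l\<^sup>1\<^sup>/\<^sup>4\<close>: three of the four powers are estimated in
  this way and the remaining one is integrated. Keeping the square root in that last integral, and not
  \<open>\<beta>\<^sup>2\<close>, is what makes the bounds summable over the levels.
\<close>

lemma poisson_integral_level_estimate:
  assumes g: "growth_function \<Psi> p" and p: "p > 1/2"
    and c: "c > 0" "\<And>s t. 0 < s \<Longrightarrow> s < t \<Longrightarrow> \<Psi> s \<le> c * (s / t) powr p * \<Psi> t"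
    and V: "V \<in> borel_measurable unit_interval" "\<And>x. x \<in> {0..1} \<Longrightarrow> 0 \<le> V x" "\<And>x. x \<in> {0..1} \<Longrightarrow> V x \<le> C"
    and mV: "(\<lambda>x. \<Psi> (V x ^ 4)) \<in> borel_measurable unit_interval"
    and int: "(LINT x|unit_interval. \<Psi> (V x ^ 4)) \<le> 1"
    and l: "0 < l" and q: "0 < q" "\<Psi> l = q" and r: "0 \<le> r" "r < 1" "2 / (1 - r) \<le> 16 * q"
  shows "(LINT x|unit_interval. poisson_integral r V x ^ 4) \<le>
      8 * (LINT x|unit_interval. (if V x ^ 4 \<le> l then V x ^ 4 else 0)) +
      32768 * c\<^sup>2 * l * (LINT x|unit_interval. (if V x ^ 4 \<le> l then 0 else sqrt (\<Psi> (V x ^ 4) / q)))"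
proof -
  define a where "a = (\<lambda>x. if V x ^ 4 \<le> l then V x else 0)"
  define b where "b = (\<lambda>x. if V x ^ 4 \<le> l then 0 else V x)"
  define \<beta> where "\<beta> = (\<lambda>x. if V x ^ 4 \<le> l then 0 else sqrt (\<Psi> (V x ^ 4) / q))"
  define \<mu> where "\<mu> = l powr (1/4)"
  have \<mu>: "\<mu> > 0" "\<mu> ^ 4 = l" using l by (auto simp: \<mu>_def powr_power)
  have C: "C \<ge> 0" using V(2,3)[of 0] by simp
  note [measurable] = V(1) mV
  have ma[measurable]: "a \<in> borel_measurable unit_interval" unfolding a_def by measurable
  have mb[measurable]: "b \<in> borel_measurable unit_interval" unfolding b_def by measurable
  have m\<beta>[measurable]: "\<beta> \<in> borel_measurable unit_interval" unfolding \<beta>_def by measurable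
  have a: "0 \<le> a x" "a x \<le> C" if "x \<in> {0..1}" for x using V(2,3)[OF that] C by (auto simp: a_def)
  have b: "0 \<le> b x" "b x \<le> C" if "x \<in> {0..1}" for x using V(2,3)[OF that] C by (auto simp: b_def)
  have Pb: "integrable unit_interval (poisson_integral r b)"
    "(LINT x|unit_interval. poisson_integral r b x) = (LINT x|unit_interval. b x)"
    by (rule poisson_integral_mean[OF r(1,2) mb b], (assumption+)?)+
  have X: "0 \<le> \<Psi> (V x ^ 4)" if "x \<in> {0..1}" for x
    by (rule growth_function_nonneg[OF g]) (use V(2)[OF that] in auto)
  have XC: "\<Psi> (V x ^ 4) \<le> \<Psi> (C ^ 4)" if "x \<in> {0..1}" for x
    using growth_function_le_iff[OF g, of "V x ^ 4" "C ^ 4"] V(2,3)[OF that] by (simp add: power_mono)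
  have b_le: "b x \<le> \<mu> * sqrt c * \<beta> x" and \<beta>_le: "0 \<le> \<beta> x" "\<beta> x \<le> \<Psi> (V x ^ 4) / q" if x: "x \<in> {0..1}" for x
  proof -
    have "b x \<le> \<mu> * sqrt c * \<beta> x \<and> 0 \<le> \<beta> x \<and> \<beta> x \<le> \<Psi> (V x ^ 4) / q"
    proof (cases "V x ^ 4 \<le> l")
      case True
      then show ?thesis using X[OF x] q by (simp add: b_def \<beta>_def)
    next
      case False
      define W where "W = V x ^ 4"
      have W: "l < W" using False by (simp add: W_def)
      then have W0: "W > 0" using l by simp
      have Vx: "V x = W powr (1/4)"
        using W0 V(2)[OF x] unfolding W_def by (simp add: powr_powr flip: powr_numeral)
      have "(W / l) powr p * q \<le> c * \<Psi> W"
      proof -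
        have "(W / l) powr p * q \<le> (W / l) powr p * (c * (l / W) powr p * \<Psi> W)"
          using c(2)[OF l W] q by (intro mult_left_mono) auto
        also have "\<dots> = ((W / l) powr p * (l / W) powr p) * (c * \<Psi> W)" by simp
        also have "(W / l) powr p * (l / W) powr p = 1"
          using W0 l by (simp flip: powr_mult)
        finally show ?thesis by simp
      qed
      then have 1: "(W / l) powr p \<le> c * (\<Psi> W / q)" using q by (simp add: pos_le_divide_eq)
      \<comment> \<open>Here \<open>p > 1/2\<close> is used: \<open>W / l > 1\<close> and \<open>1/4 < p / 2\<close>.\<close>
      have "(W / l) powr (1/4) \<le> (W / l) powr (p / 2)"
        using W l p by (intro powr_mono) auto
      also have "\<dots> = sqrt ((W / l) powr p)"
        by (simp add: powr_half_sqrt[symmetric] powr_powr)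
      also have "\<dots> \<le> sqrt (c * (\<Psi> W / q))" using 1 by simp
      finally have "W powr (1/4) / \<mu> \<le> sqrt c * sqrt (\<Psi> W / q)"
        using W0 l by (simp add: \<mu>_def powr_divide flip: real_sqrt_mult)
      then have "V x \<le> \<mu> * (sqrt c * sqrt (\<Psi> W / q))"
        using \<mu>(1) by (simp add: Vx pos_divide_le_eq mult.commute)
      moreover have "1 \<le> \<Psi> W / q"
        using growth_function_le_iff[OF g, of l W] W l q by simp
      then have "sqrt (\<Psi> W / q) \<le> \<Psi> W / q"
        using self_le_power[of "\<Psi> W / q" 2] by (intro real_le_lsqrt) auto
      ultimately show ?thesis using False X[OF x] q by (simp add: b_def \<beta>_def W_def)
    qed
    then show "b x \<le> \<mu> * sqrt c * \<beta> x" "0 \<le> \<beta> x" "\<beta> x \<le> \<Psi> (V x ^ 4) / q" by auto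
  qed
  have i\<Psi>: "integrable unit_interval (\<lambda>x. \<Psi> (V x ^ 4))"
    by (rule integrable_unit_interval_bounded[OF mV, of "\<Psi> (C ^ 4)"]) (use X XC in auto)
  have i\<beta>: "integrable unit_interval \<beta>"
  proof (rule integrable_unit_interval_bounded[OF m\<beta>, of "\<Psi> (C ^ 4) / q"])
    fix x :: real assume x: "x \<in> {0..1}"
    have "\<Psi> (V x ^ 4) / q \<le> \<Psi> (C ^ 4) / q" using XC[OF x] q by (intro divide_right_mono) auto
    then show "\<bar>\<beta> x\<bar> \<le> \<Psi> (C ^ 4) / q" using \<beta>_le[OF x] by simp
  qed
  have ib: "integrable unit_interval b"
    by (rule integrable_unit_interval_bounded[OF mb, of C]) (use b in auto)
  have int_b: "(LINT x|unit_interval. b x) \<le> \<mu> * sqrt c * (LINT x|unit_interval. \<beta> x)"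
  proof -
    have "(LINT x|unit_interval. b x) \<le> (LINT x|unit_interval. \<mu> * sqrt c * \<beta> x)"
      by (rule integral_mono[OF ib integrable_mult_right[OF i\<beta>]]) (use b_le in simp)
    then show ?thesis by simp
  qed
  have "(LINT x|unit_interval. \<beta> x) \<le> (LINT x|unit_interval. \<Psi> (V x ^ 4) / q)"
    by (rule integral_mono[OF i\<beta>]) (use \<beta>_le i\<Psi> in auto)
  also have "\<dots> \<le> 1 / q" using int q by (simp add: divide_right_mono)
  finally have int_\<beta>: "(LINT x|unit_interval. \<beta> x) \<le> 1 / q" .
  have Pb_le: "poisson_integral r b x \<le> 16 * sqrt c * \<mu>" for x
  proof -
    have "0 \<le> (LINT x|unit_interval. b x)" by (rule Bochner_Integration.integral_nonneg) (use b in simp)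
    have "poisson_integral r b x \<le> 2 / (1 - r) * (LINT x|unit_interval. b x)"
      by (rule poisson_integral_le[OF r(1,2) mb b])
    also have "\<dots> \<le> 16 * q * (LINT x|unit_interval. b x)" by (rule mult_right_mono) fact+
    also have "\<dots> \<le> 16 * q * (\<mu> * sqrt c * (1 / q))"
    proof (rule mult_left_mono)
      have "\<mu> * sqrt c * (LINT x|unit_interval. \<beta> x) \<le> \<mu> * sqrt c * (1 / q)"
        using int_\<beta> \<mu> c by (intro mult_left_mono) auto
      with int_b show "(LINT x|unit_interval. b x) \<le> \<mu> * sqrt c * (1 / q)" by linarith
    qed (use q in auto)
    finally show ?thesis using q by (simp add: mult_ac)
  qed
  have add: "poisson_integral r V x = poisson_integral r a x + poisson_integral r b x" for x
  proof -
    have "(\<lambda>y. poisson r x y * V y) = (\<lambda>y. poisson r x y * a y + poisson r x y * b y)"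
      by (auto simp: a_def b_def)
    then show ?thesis
      unfolding poisson_integral_def
      using Bochner_Integration.integral_add[OF poisson_kernel_integrable[OF r(1,2) ma a] poisson_kernel_integrable[OF r(1,2) mb b]]
      by simp
  qed
  have ma4: "(\<lambda>x. a x ^ 4) \<in> borel_measurable unit_interval" by measurable
  have a4: "0 \<le> a x ^ 4" "a x ^ 4 \<le> C ^ 4" if "x \<in> {0..1}" for x using a[OF that] by (auto intro: power_mono)
  have Pa4: "integrable unit_interval (poisson_integral r (\<lambda>y. a y ^ 4))"
    "(LINT x|unit_interval. poisson_integral r (\<lambda>y. a y ^ 4) x) = (LINT x|unit_interval. a x ^ 4)"
    by (rule poisson_integral_mean[OF r(1,2) ma4 a4], (assumption+)?)+
  have point: "poisson_integral r V x ^ 4 \<le>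
      8 * poisson_integral r (\<lambda>y. a y ^ 4) x + 8 * (16 * sqrt c * \<mu>) ^ 3 * poisson_integral r b x" for x
  proof -
    define s where "s = poisson_integral r a x"
    define t where "t = poisson_integral r b x"
    have s: "0 \<le> s" unfolding s_def by (rule poisson_integral_nonneg[OF r(1,2) ma a])
    have t: "0 \<le> t" unfolding t_def by (rule poisson_integral_nonneg[OF r(1,2) mb b])
    have "(s + t) ^ 4 \<le> 8 * (s ^ 4 + t ^ 4)"
    proof -
      have "(s + t)\<^sup>2 \<le> 2 * (s\<^sup>2 + t\<^sup>2)"
        using sum_squares_bound[of s t] by (simp add: power2_eq_square algebra_simps)
      then have "((s + t)\<^sup>2)\<^sup>2 \<le> (2 * (s\<^sup>2 + t\<^sup>2))\<^sup>2" by (intro power_mono) auto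
      also have "\<dots> \<le> 8 * ((s\<^sup>2)\<^sup>2 + (t\<^sup>2)\<^sup>2)"
        using sum_squares_bound[of "s\<^sup>2" "t\<^sup>2"] by (simp add: power2_eq_square algebra_simps)
      finally show ?thesis by simp
    qed
    also have "\<dots> = 8 * s ^ 4 + 8 * (t ^ 3 * t)" by (simp add: power_numeral_reduce)
    also have "\<dots> \<le> 8 * poisson_integral r (\<lambda>y. a y ^ 4) x + 8 * ((16 * sqrt c * \<mu>) ^ 3 * t)"
      unfolding s_def using t Pb_le[of x] 
      by (intro add_mono mult_left_mono poisson_integral_power4_le[OF r(1,2) ma a] mult_right_mono power_mono) (auto simp: t_def)
    finally show ?thesis by (simp add: add s_def t_def)
  qed
  have "(LINT x|unit_interval. poisson_integral r V x ^ 4) \<le>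
    (LINT x|unit_interval. 8 * poisson_integral r (\<lambda>y. a y ^ 4) x + 8 * (16 * sqrt c * \<mu>) ^ 3 * poisson_integral r b x)"
  proof (rule integral_mono')
    show "integrable unit_interval (\<lambda>x. 8 * poisson_integral r (\<lambda>y. a y ^ 4) x + 8 * (16 * sqrt c * \<mu>) ^ 3 * poisson_integral r b x)"
      by (intro Bochner_Integration.integrable_add integrable_mult_right Pa4 Pb)
    fix x show "0 \<le> 8 * poisson_integral r (\<lambda>y. a y ^ 4) x + 8 * (16 * sqrt c * \<mu>) ^ 3 * poisson_integral r b x"
      by (rule order_trans[OF _ point]) simp
  qed (rule point)
  also have "\<dots> = 8 * (LINT x|unit_interval. a x ^ 4) + 8 * (16 * sqrt c * \<mu>) ^ 3 * (LINT x|unit_interval. b x)"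
    by (subst Bochner_Integration.integral_add) (auto simp: Pa4 Pb)
  also have "\<dots> \<le> 8 * (LINT x|unit_interval. a x ^ 4) + 8 * (16 * sqrt c * \<mu>) ^ 3 * (\<mu> * sqrt c * (LINT x|unit_interval. \<beta> x))"
    using c \<mu> by (intro add_left_mono mult_left_mono int_b) auto
  also have "8 * (16 * sqrt c * \<mu>) ^ 3 * (\<mu> * sqrt c * (LINT x|unit_interval. \<beta> x))
      = 32768 * (sqrt c) ^ 4 * \<mu> ^ 4 * (LINT x|unit_interval. \<beta> x)"
    by (simp add: power_mult_distrib power_numeral_reduce mult_ac)
  also have "sqrt c ^ 4 = c\<^sup>2"
  proof -
    have "sqrt c ^ 4 = (sqrt c ^ 2) ^ 2" by (simp flip: power_mult)
    then show ?thesis using c by simp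
  qed
  also have "(LINT x|unit_interval. a x ^ 4) = (LINT x|unit_interval. (if V x ^ 4 \<le> l then V x ^ 4 else 0))"
    by (intro Bochner_Integration.integral_cong) (auto simp: a_def)
  finally show ?thesis unfolding \<mu>(2) by (simp add: \<beta>_def)
qed

text \<open>
  Sum of the level estimates. The tail condition bounds each single weight, \<open>w\<^sub>j l\<^sub>j \<le> 4\<^sup>j\<close>, so the large
  parts contribute pointwise a multiple of \<open>Y \<Sum> 2\<^sup>j\<close> over \<open>2\<^sup>j < Y\<close>, with \<open>Y = \<Psi>(V\<^sup>4)\<^sup>1\<^sup>/\<^sup>2\<close>; this is at most
  \<open>2 Y\<^sup>2\<close>. The small parts are summed by \<open>weighted_truncations_le\<close>.
\<close>

lemma weighted_poisson_integrals_le: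
  assumes g: "growth_function \<Psi> p" and p: "p > 1/2"
    and c: "c > 0" "\<And>s t. 0 < s \<Longrightarrow> s < t \<Longrightarrow> \<Psi> s \<le> c * (s / t) powr p * \<Psi> t"
    and V: "V \<in> borel_measurable unit_interval" "\<And>x. x \<in> {0..1} \<Longrightarrow> 0 \<le> V x" "\<And>x. x \<in> {0..1} \<Longrightarrow> V x \<le> C"
    and mV: "(\<lambda>x. \<Psi> (V x ^ 4)) \<in> borel_measurable unit_interval"
    and int: "(LINT x|unit_interval. \<Psi> (V x ^ 4)) \<le> 1"
    and r: "\<And>j. 0 \<le> r j" "\<And>j. r j < 1" "\<And>j. 2 / (1 - r j) \<le> 16 * 4 ^ j"
    and w: "\<And>j. j \<le> J \<Longrightarrow> 0 \<le> w j"
    and tail: "\<And>i. i \<le> J \<Longrightarrow> (\<Sum>j\<in>{i..J}. w j) \<le> 4 ^ i / growth_inv \<Psi> (4 ^ i)"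
  shows "(\<Sum>j\<le>J. w j * (LINT x|unit_interval. poisson_integral (r j) V x ^ 4)) \<le> 8 + 65536 * c\<^sup>2"
proof -
  define l where "l = (\<lambda>j::nat. growth_inv \<Psi> (4 ^ j))"
  have l: "0 < l j" "\<Psi> (l j) = 4 ^ j" for j
    using growth_inv_pos[OF g, of "4 ^ j"] growth_inv_props(2)[OF g, of "4 ^ j"] by (auto simp: l_def)
  have wl: "w j * l j \<le> 4 ^ j" if "j \<le> J" for j
  proof -
    have "w j \<le> (\<Sum>j\<in>{j..J}. w j)" using that w by (intro member_le_sum) auto
    also have "\<dots> \<le> 4 ^ j / l j" using tail[OF that] by (simp add: l_def)
    finally show ?thesis using l(1)[of j] by (simp add: pos_le_divide_eq)
  qed
  define A where "A = (\<lambda>j x. if V x ^ 4 \<le> l j then V x ^ 4 else 0)"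
  define \<beta> where "\<beta> = (\<lambda>j x. if V x ^ 4 \<le> l j then 0 else sqrt (\<Psi> (V x ^ 4) / 4 ^ j))"
  have X: "0 \<le> \<Psi> (V x ^ 4)" if "x \<in> {0..1}" for x
    by (rule growth_function_nonneg[OF g]) (use V(2)[OF that] in auto)
  have XC: "\<Psi> (V x ^ 4) \<le> \<Psi> (C ^ 4)" if "x \<in> {0..1}" for x
    using growth_function_le_iff[OF g, of "V x ^ 4" "C ^ 4"] V(2,3)[OF that] by (simp add: power_mono)
  note [measurable] = V(1) mV
  have i\<Psi>: "integrable unit_interval (\<lambda>x. \<Psi> (V x ^ 4))"
    by (rule integrable_unit_interval_bounded[OF mV, of "\<Psi> (C ^ 4)"]) (use X XC in auto)
  have iA: "integrable unit_interval (A j)" for j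
  proof (rule integrable_unit_interval_bounded[of _ "C ^ 4"])
    show "A j \<in> borel_measurable unit_interval" unfolding A_def by measurable
    fix x :: real assume x: "x \<in> {0..1}"
    have "V x ^ 4 \<le> C ^ 4" using V(2,3)[OF x] by (intro power_mono)
    then show "\<bar>A j x\<bar> \<le> C ^ 4" by (auto simp: A_def intro: order_trans)
  qed
  have i\<beta>: "integrable unit_interval (\<beta> j)" for j
  proof (rule integrable_unit_interval_bounded[of _ "sqrt (\<Psi> (C ^ 4) / 4 ^ j)"])
    show "\<beta> j \<in> borel_measurable unit_interval" unfolding \<beta>_def by measurable
    fix x :: real assume x: "x \<in> {0..1}"
    have "0 \<le> \<Psi> (V x ^ 4) / 4 ^ j" "\<Psi> (V x ^ 4) / 4 ^ j \<le> \<Psi> (C ^ 4) / 4 ^ j"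
      using X[OF x] XC[OF x] by (auto intro: divide_right_mono)
    moreover from this have "0 \<le> \<Psi> (C ^ 4) / 4 ^ j" by linarith
    ultimately show "\<bar>\<beta> j x\<bar> \<le> sqrt (\<Psi> (C ^ 4) / 4 ^ j)" unfolding \<beta>_def by auto
  qed
  have "(\<Sum>j\<le>J. w j * (LINT x|unit_interval. poisson_integral (r j) V x ^ 4)) \<le>
     (\<Sum>j\<le>J. 8 * (LINT x|unit_interval. w j * A j x) + 32768 * c\<^sup>2 * (LINT x|unit_interval. 4 ^ j * \<beta> j x))"
  proof (intro sum_mono)
    fix j assume "j \<in> {..J}"
    then have j: "j \<le> J" by simp
    have q: "(0::real) < 4 ^ j" by simp
    have B0: "0 \<le> (LINT x|unit_interval. \<beta> j x)"
      by (rule Bochner_Integration.integral_nonneg) (use X in \<open>simp add: \<beta>_def\<close>)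
    have "w j * (LINT x|unit_interval. poisson_integral (r j) V x ^ 4) \<le>
       w j * (8 * (LINT x|unit_interval. A j x) + 32768 * c\<^sup>2 * l j * (LINT x|unit_interval. \<beta> j x))"
      unfolding A_def \<beta>_def
      by (intro mult_left_mono w j
          poisson_integral_level_estimate[OF g p c V mV int l(1) q l(2) r(1) r(2) r(3)])
    also have "\<dots> = 8 * (w j * (LINT x|unit_interval. A j x)) + 32768 * c\<^sup>2 * ((w j * l j) * (LINT x|unit_interval. \<beta> j x))"
      by (simp add: algebra_simps)
    also have "\<dots> \<le> 8 * (w j * (LINT x|unit_interval. A j x)) + 32768 * c\<^sup>2 * (4 ^ j * (LINT x|unit_interval. \<beta> j x))"
      by (intro add_left_mono mult_left_mono mult_right_mono wl j B0) simp
    finally show "w j * (LINT x|unit_interval. poisson_integral (r j) V x ^ 4) \<le>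
       8 * (LINT x|unit_interval. w j * A j x) + 32768 * c\<^sup>2 * (LINT x|unit_interval. 4 ^ j * \<beta> j x)"
      by simp
  qed
  also have "\<dots> = 8 * (LINT x|unit_interval. (\<Sum>j\<le>J. w j * A j x)) + 32768 * c\<^sup>2 * (LINT x|unit_interval. (\<Sum>j\<le>J. 4 ^ j * \<beta> j x))"
    using iA i\<beta> by (simp add: Bochner_Integration.integral_sum sum.distrib sum_distrib_left)
  also have "\<dots> \<le> 8 * 1 + 32768 * c\<^sup>2 * 2"
  proof (intro add_mono mult_left_mono)
    have "(LINT x|unit_interval. (\<Sum>j\<le>J. w j * A j x)) \<le> (LINT x|unit_interval. \<Psi> (V x ^ 4))"
    proof (rule integral_mono)
      fix x assume "x \<in> space unit_interval"
      then have "0 \<le> V x ^ 4" using V(2) by simp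
      then show "(\<Sum>j\<le>J. w j * A j x) \<le> \<Psi> (V x ^ 4)"
        unfolding A_def by (intro weighted_truncations_le[OF g _ l(1) w]) (use tail l in \<open>auto simp: l_def\<close>)
    qed (intro Bochner_Integration.integrable_sum integrable_mult_right iA i\<Psi>)+
    then show "(LINT x|unit_interval. (\<Sum>j\<le>J. w j * A j x)) \<le> 1" using int by simp
    have "(LINT x|unit_interval. (\<Sum>j\<le>J. 4 ^ j * \<beta> j x)) \<le> (LINT x|unit_interval. 2 * \<Psi> (V x ^ 4))"
    proof (rule integral_mono)
      fix x assume "x \<in> space unit_interval"
      then have x: "x \<in> {0..1}" by simp
      define Y where "Y = sqrt (\<Psi> (V x ^ 4))"
      have Y: "0 \<le> Y" "Y * Y = \<Psi> (V x ^ 4)" using X[OF x] by (auto simp: Y_def)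
      have "4 ^ j * \<beta> j x = Y * (if 2 ^ j < Y then 2 ^ j else 0)" for j
      proof -
        have s4: "sqrt (4 ^ j) = 2 ^ j" by (simp add: real_sqrt_power)
        have "V x ^ 4 \<le> l j \<longleftrightarrow> \<Psi> (V x ^ 4) \<le> 4 ^ j"
          using growth_function_le_iff[OF g, of "V x ^ 4" "l j"] V(2)[OF x] l[of j] by simp
        also have "\<dots> \<longleftrightarrow> Y \<le> 2 ^ j"
          unfolding Y_def s4[symmetric] by simp
        finally have "V x ^ 4 \<le> l j \<longleftrightarrow> \<not> 2 ^ j < Y" by (simp add: not_less)
        moreover have "(4::real) ^ j = 2 ^ j * 2 ^ j" by (simp flip: power_mult_distrib)
        ultimately show ?thesis by (simp add: \<beta>_def real_sqrt_divide s4 flip: Y_def)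
      qed
      then have "(\<Sum>j\<le>J. 4 ^ j * \<beta> j x) = Y * (\<Sum>j\<le>J. if 2 ^ j < Y then 2 ^ j else 0)"
        by (simp add: sum_distrib_left)
      also have "\<dots> \<le> Y * (2 * Y)" by (intro mult_left_mono sum_powers_of_two_below Y)
      finally show "(\<Sum>j\<le>J. 4 ^ j * \<beta> j x) \<le> 2 * \<Psi> (V x ^ 4)" using Y by simp
    qed (intro Bochner_Integration.integrable_sum integrable_mult_right i\<beta> i\<Psi>)+
    then show "(LINT x|unit_interval. (\<Sum>j\<le>J. 4 ^ j * \<beta> j x)) \<le> 2" using int by simp
  qed auto
  finally show ?thesis by simp
qed


section \<open>The coefficient inequality\<close>

text \<open>
  On a block \<open>\<phi>\<close> is replaced by its value at the left end; Abel summation does the rest. The last weight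
  is the value of \<open>\<phi>\<close> itself, so that the weights with index at least \<open>i\<close> add up to \<open>\<phi>(4\<^sup>i)\<close>.
\<close>

lemma base4_summation_by_parts:
  fixes \<phi> u :: "nat \<Rightarrow> real"
  assumes u: "\<And>n. 0 \<le> u n" and \<phi>: "\<And>m n. 1 \<le> m \<Longrightarrow> m \<le> n \<Longrightarrow> \<phi> n \<le> \<phi> m"
  shows "(\<Sum>n\<in>{1..<4 ^ Suc J}. \<phi> n * u n) \<le>
    (\<Sum>j\<le>J. (if j = J then \<phi> (4 ^ j) else \<phi> (4 ^ j) - \<phi> (4 ^ Suc j)) * (\<Sum>n\<in>{1..<4 ^ Suc j}. u n))"
proof -
  define S where "S = (\<lambda>j. \<Sum>n\<in>{1..<4 ^ Suc j :: nat}. u n)"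
  have "(\<Sum>n\<in>{1..<4 ^ Suc J}. \<phi> n * u n) \<le> (\<Sum>j<J. (\<phi> (4 ^ j) - \<phi> (4 ^ Suc j)) * S j) + \<phi> (4 ^ J) * S J"
  proof (induction J)
    case 0
    then show ?case unfolding S_def sum_distrib_left using u by (auto intro!: sum_mono mult_right_mono \<phi>)
  next
    case (Suc J)
    have split: "{1..<4 ^ Suc (Suc J) :: nat} = {1..<4 ^ Suc J} \<union> {4 ^ Suc J..<4 ^ Suc (Suc J)}"
      by (intro ivl_disj_un_two(3)[symmetric]) auto
    have us: "(\<Sum>n\<in>{1..<4 ^ Suc (Suc J)}. f n) = (\<Sum>n\<in>{1..<4 ^ Suc J}. f n) + (\<Sum>n\<in>{4 ^ Suc J..<4 ^ Suc (Suc J)}. f n)"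
      for f :: "nat \<Rightarrow> real"
      unfolding split by (intro sum.union_disjoint) auto
    have "(\<Sum>n\<in>{4 ^ Suc J..<4 ^ Suc (Suc J)}. \<phi> n * u n) \<le> (\<Sum>n\<in>{4 ^ Suc J..<4 ^ Suc (Suc J)}. \<phi> (4 ^ Suc J) * u n)"
      using u by (intro sum_mono mult_right_mono \<phi>) auto
    also have "\<dots> = \<phi> (4 ^ Suc J) * (S (Suc J) - S J)"
      unfolding S_def us[of u] by (simp add: sum_distrib_left)
    finally show ?case
      unfolding us[of "\<lambda>n. \<phi> n * u n"] using Suc by (simp add: algebra_simps)
  qed
  also have "\<dots> = (\<Sum>j\<le>J. (if j = J then \<phi> (4 ^ j) else \<phi> (4 ^ j) - \<phi> (4 ^ Suc j)) * S j)"
    by (simp flip: lessThan_Suc_atMost)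
  finally show ?thesis by (simp add: S_def)
qed

text \<open>
  Summation by parts, Hardy's inequality at the radii \<open>1 - 4\<^sup>-\<^sup>j/8\<close>, Poisson domination of \<open>|H|\<close> and the
  weighted bound for Poisson integrals fit together here.
\<close>

lemma hardy_orlicz_coefficients_on_circle:
  assumes g: "growth_function \<Psi> p" and p: "p > 1/2"
    and c: "c > 0" "\<And>s t. 0 < s \<Longrightarrow> s < t \<Longrightarrow> \<Psi> s \<le> c * (s / t) powr p * \<Psi> t"
    and F: "F holomorphic_on ball 0 \<rho>" "\<rho> > 1" "\<And>z. cmod z = 1 \<Longrightarrow> F z \<noteq> 0"
    and int: "(LINT x|unit_interval. \<Psi> (cmod (F (circ x)))) \<le> 1"
  shows "(\<Sum>n\<in>{1..N}. cmod ((deriv ^^ n) F 0 / fact n) / growth_inv \<Psi> (real n)) \<le> 6 * pi * (8 + 65536 * c\<^sup>2)"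
proof -
  obtain B H R where B: "B holomorphic_on ball 0 1" "\<And>z. z \<in> ball 0 1 \<Longrightarrow> cmod (B z) \<le> 1"
    and R: "R > 1" and H: "H holomorphic_on ball 0 R" 
    and FBH: "\<And>z. z \<in> ball 0 1 \<Longrightarrow> F z = B z * H z ^ 4" and bd: "\<And>z. cmod z = 1 \<Longrightarrow> cmod (H z) ^ 4 = cmod (F z)"
    using blaschke_root_factorization[OF F, of 4] by (metis zero_less_numeral)
  have H1: "H holomorphic_on ball 0 1" using R by (intro holomorphic_on_subset[OF H]) auto
  define V where "V = (\<lambda>x. cmod (H (circ x)))"
  have contV: "continuous_on A V" for A
    unfolding V_def using R
    by (intro continuous_intros continuous_on_compose2[OF holomorphic_on_imp_continuous_on[OF H]]) auto
  have V4: "V x ^ 4 = cmod (F (circ x))" for x by (simp add: V_def bd)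
  have Vm: "V \<in> borel_measurable unit_interval"
    by (intro borel_measurable_unit_intervalI borel_measurable_continuous_onI contV)
  have "compact (V ` {0..1})" by (intro compact_continuous_image contV) auto
  then obtain C where C: "\<And>x. x \<in> {0..1} \<Longrightarrow> V x \<le> C"
    using compact_imp_bounded[of "V ` {0..1}"] unfolding bounded_iff by (metis abs_le_D1 imageI real_norm_def)
  have V0: "0 \<le> V x" for x by (simp add: V_def)
  have "continuous_on UNIV (\<lambda>x. \<Psi> (V x ^ 4))"
    using g by (intro continuous_on_compose2[of "{0..}" \<Psi> UNIV "\<lambda>x. V x ^ 4"] continuous_intros contV)
       (auto simp: growth_function_def V0)
  then have \<Psi>m: "(\<lambda>x. \<Psi> (V x ^ 4)) \<in> borel_measurable unit_interval"
    by (intro borel_measurable_unit_intervalI borel_measurable_continuous_onI)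
  have intV: "(LINT x|unit_interval. \<Psi> (V x ^ 4)) \<le> 1" unfolding V4 by (rule int)
  define r where "r = (\<lambda>j::nat. 1 - 1 / (8 * 4 ^ j) :: real)"
  have r: "0 < r j" "r j < 1" "2 / (1 - r j) \<le> 16 * 4 ^ j" for j
  proof -
    have "(1::real) \<le> 4 ^ j" by simp
    then have "(1::real) < 8 * 4 ^ j" by linarith
    then show "0 < r j" by (simp add: r_def)
  qed (auto simp: r_def)
  define u where "u = (\<lambda>n. cmod ((deriv ^^ n) F 0 / fact n) / real n)"
  define \<phi> where "\<phi> = (\<lambda>n::nat. real n / growth_inv \<Psi> (real n))"
  define w where "w = (\<lambda>J j. if j = J then \<phi> (4 ^ j) else \<phi> (4 ^ j) - \<phi> (4 ^ Suc j))"
  have u0: "0 \<le> u n" for n by (simp add: u_def)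
  have \<phi>: "\<phi> n \<le> \<phi> m" if "1 \<le> m" "m \<le> n" for m n
    unfolding \<phi>_def by (rule growth_inv_ratio_antimono[OF g]) (use that in auto)
  have \<phi>0: "0 \<le> \<phi> n" for n
    using growth_inv_props(1)[OF g, of "real n"] by (simp add: \<phi>_def)
  have w0: "0 \<le> w J j" for J j
    using \<phi>[of "4 ^ j" "4 ^ Suc j"] \<phi>0 by (simp add: w_def)
  have tail: "(\<Sum>j\<in>{i..J}. w J j) \<le> 4 ^ i / growth_inv \<Psi> (4 ^ i)" if "i \<le> J" for i J
  proof -
    have "(\<Sum>j\<in>{i..J}. w J j) = (\<Sum>j\<in>{i..<J}. w J j) + w J J"
      using that by (simp add: sum.last_plus add.commute)
    also have "(\<Sum>j\<in>{i..<J}. w J j) = (\<Sum>j\<in>{i..<J}. - (\<phi> (4 ^ Suc j) - \<phi> (4 ^ j)))"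
      by (intro sum.cong) (auto simp: w_def)
    also have "\<dots> = - (\<phi> (4 ^ J) - \<phi> (4 ^ i))"
      unfolding sum_negf using sum_Suc_diff'[OF that, of "\<lambda>j. \<phi> (4 ^ j)"] by simp
    finally show ?thesis by (simp add: w_def \<phi>_def)
  qed
  have block: "(\<Sum>n\<in>{1..<4 ^ Suc j}. u n) \<le> 6 * pi * (LINT x|unit_interval. poisson_integral (r j) V x ^ 4)" for j
  proof -
    define a where "a = (\<lambda>n. cmod ((deriv ^^ n) F 0 / fact n) * r j ^ n / real (n + 2))"
    have a0: "0 \<le> a n" for n using r(1)[of j] by (simp add: a_def)
    have ua: "u n \<le> 6 * a n" if n: "n \<in> {1..<4 ^ Suc j}" for n
    proof -
      \<comment> \<open>Bernoulli's inequality: \<open>r j ^ n \<ge> 1 - n / (8 * 4 ^ j) \<ge> 1/2\<close> on the whole range of \<open>n\<close>.\<close>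
      have "real n \<le> real (4 ^ Suc j)" using n by (intro of_nat_mono) auto
      then have "real n / (8 * 4 ^ j) \<le> 1/2" by (simp add: field_simps)
      then have "1/2 \<le> 1 + real n * (- (1 / (8 * 4 ^ j)))" by simp
      also have "\<dots> \<le> (1 + (- (1 / (8 * 4 ^ j)))) ^ n"
      proof (rule Bernoulli_inequality)
        have "(1::real) \<le> 4 ^ j" by simp
        then have "(1::real) \<le> 8 * 4 ^ j" by linarith
        then show "- 1 \<le> - (1 / (8 * 4 ^ j) :: real)" by simp
      qed
      finally have "1/2 \<le> r j ^ n" by (simp add: r_def)
      moreover have "1 / real n \<le> 3 / real (n + 2)" using n by (simp add: field_simps)
      ultimately have "(1/2) * (1 / real n) \<le> r j ^ n * (3 / real (n + 2))" by (intro mult_mono) auto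
      then have "1 / real n \<le> 6 * (r j ^ n / real (n + 2))" by (simp add: field_simps)
      then have "cmod ((deriv ^^ n) F 0 / fact n) * (1 / real n) \<le> cmod ((deriv ^^ n) F 0 / fact n) * (6 * (r j ^ n / real (n + 2)))"
        by (intro mult_left_mono) auto
      then show ?thesis by (simp add: u_def a_def mult_ac)
    qed
    have "(\<Sum>n\<in>{1..<4 ^ Suc j}. u n) \<le> (\<Sum>n\<in>{1..<4 ^ Suc j}. 6 * a n)" by (rule sum_mono[OF ua])
    also have "\<dots> \<le> (\<Sum>n\<le>4 ^ Suc j. 6 * a n)" by (intro sum_mono2) (auto simp: a0)
    also have "\<dots> \<le> 6 * (pi * (LINT t|unit_interval. cmod (H (of_real (r j) * circ t)) ^ 4))"
      unfolding sum_distrib_left[symmetric] a_def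
      by (intro mult_left_mono hardy_inequality_factored[OF B H1 FBH r(1,2)]) auto
    also have "(LINT t|unit_interval. cmod (H (of_real (r j) * circ t)) ^ 4) \<le> (LINT x|unit_interval. poisson_integral (r j) V x ^ 4)"
    proof (rule integral_mono)
      fix x
      have "cmod (H (of_real (r j) * circ x)) \<le> poisson_integral (r j) V x"
        unfolding poisson_integral_def V_def using r[of j] by (intro norm_le_poisson_mean[OF H R]) auto
      then show "cmod (H (of_real (r j) * circ x)) ^ 4 \<le> poisson_integral (r j) V x ^ 4"
        by (intro power_mono) auto
    next
      have "continuous_on {0..1} (\<lambda>t. H (of_real (r j) * circ t))"
        using r[of j] by (intro continuous_on_compose2[OF holomorphic_on_imp_continuous_on[OF H1]] continuous_intros)
           (auto simp: norm_mult)
      then show "integrable unit_interval (\<lambda>t. cmod (H (of_real (r j) * circ t)) ^ 4)"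
        by (intro continuous_unit_interval_integral continuous_intros)
    next
      have rj: "0 \<le> r j" "r j < 1" using r[of j] by auto
      note P = poisson_integral_mean(1)[OF rj Vm V0 C] poisson_integral_nonneg[OF rj Vm V0 C]
        poisson_integral_le[OF rj Vm V0 C]
      let ?M = "2 / (1 - r j) * (LINT y|unit_interval. V y)"
      show "integrable unit_interval (\<lambda>x. poisson_integral (r j) V x ^ 4)"
      proof (rule integrable_unit_interval_bounded[where C = "?M ^ 4"])
        show "(\<lambda>x. poisson_integral (r j) V x ^ 4) \<in> borel_measurable unit_interval"
          using P(1) by (intro borel_measurable_power) auto
        show "\<bar>poisson_integral (r j) V x ^ 4\<bar> \<le> ?M ^ 4" for x
          using P(2,3)[of x] by (simp only: power_abs abs_of_nonneg power_mono)
      qed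
    qed
    finally show ?thesis by simp
  qed
  obtain J where J: "N < 4 ^ Suc J"
  proof -
    have "N < 4 ^ N" by (rule power_gt_expt) auto
    also have "(4::nat) ^ N \<le> 4 ^ Suc N" by simp
    finally show ?thesis using that by blast
  qed
  have "(\<Sum>n\<in>{1..N}. cmod ((deriv ^^ n) F 0 / fact n) / growth_inv \<Psi> (real n)) = (\<Sum>n\<in>{1..N}. \<phi> n * u n)"
    by (intro sum.cong) (auto simp: u_def \<phi>_def)
  also have "\<dots> \<le> (\<Sum>n\<in>{1..<4 ^ Suc J}. \<phi> n * u n)"
    using J by (intro sum_mono2) (auto simp: u0 \<phi>0)
  also have "\<dots> \<le> (\<Sum>j\<le>J. w J j * (\<Sum>n\<in>{1..<4 ^ Suc j}. u n))"
    unfolding w_def by (rule base4_summation_by_parts[OF u0 \<phi>])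
  also have "\<dots> \<le> (\<Sum>j\<le>J. w J j * (6 * pi * (LINT x|unit_interval. poisson_integral (r j) V x ^ 4)))"
    by (intro sum_mono mult_left_mono block w0)
  also have "\<dots> = 6 * pi * (\<Sum>j\<le>J. w J j * (LINT x|unit_interval. poisson_integral (r j) V x ^ 4))"
    unfolding sum_distrib_left by (simp only: mult_ac)
  also have "\<dots> \<le> 6 * pi * (8 + 65536 * c\<^sup>2)"
  proof (intro mult_left_mono)
    show "(\<Sum>j\<le>J. w J j * (LINT x|unit_interval. poisson_integral (r j) V x ^ 4)) \<le> 8 + 65536 * c\<^sup>2"
      by (rule weighted_poisson_integrals_le[OF g p c Vm V0 C \<Psi>m intV _ _ r(3) w0 tail]) (use r in \<open>auto intro: less_imp_le\<close>)
  qed auto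
  finally show ?thesis .
qed

lemma nn_integral_circle_unit_interval:
  assumes "f \<in> borel_measurable borel"
  shows "(\<integral>\<^sup>+\<theta>\<in>{0..<1}. ennreal (f \<theta>) \<partial>lborel) = (\<integral>\<^sup>+\<theta>. ennreal (f \<theta>) \<partial>unit_interval)"
proof -
  have "(\<integral>\<^sup>+\<theta>\<in>{0..<1}. ennreal (f \<theta>) \<partial>lborel) = (\<integral>\<^sup>+\<theta>\<in>{0..1}. ennreal (f \<theta>) \<partial>lborel)"
  proof (rule nn_integral_cong_AE)
    have "AE \<theta> in lborel. \<theta> \<noteq> (1::real)" by (rule AE_lborel_singleton)
    then show "AE \<theta> in lborel. ennreal (f \<theta>) * indicator {0..<1} \<theta> = ennreal (f \<theta>) * indicator {0..1} \<theta>"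
      by eventually_elim (auto simp: indicator_def)
  qed
  then show ?thesis
    by (simp add: unit_interval_def nn_integral_restrict_space)
qed

text \<open>
  The zeros of a nonconstant \<open>F\<close> in a smaller closed disc are finite in number, so radii \<open>R\<close> without zeros
  on \<open>|z| = R\<close> accumulate at \<open>1\<close>. The bound for \<open>F(Rz)\<close> is uniform in \<open>R\<close> and passes to the limit.
\<close>

lemma hardy_orlicz_coefficients_unit_modular:
  assumes g: "growth_function \<Psi> p" and p: "p > 1/2"
    and c: "c > 0" "\<And>s t. 0 < s \<Longrightarrow> s < t \<Longrightarrow> \<Psi> s \<le> c * (s / t) powr p * \<Psi> t"
    and F: "F holomorphic_on ball 0 1" and mod: "hardy_modular \<Psi> F \<le> 1"
  shows "(\<Sum>n\<in>{1..N}. cmod ((deriv ^^ n) F 0 / fact n) / growth_inv \<Psi> (real n)) \<le> 6 * pi * (8 + 65536 * c\<^sup>2)"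
    (is "?S \<le> ?M")
proof (cases "F constant_on ball 0 1")
  case True
  then obtain k where k: "\<And>z. z \<in> ball 0 1 \<Longrightarrow> F z = k" by (auto simp: constant_on_def)
  have "(\<lambda>n. (if n = 0 then k else 0) * z ^ n) sums F z" if "z \<in> ball 0 1" for z
  proof -
    have "(\<lambda>n. if n = 0 then k * z ^ n else 0) sums (k * z ^ 0)" by (rule sums_single)
    then show ?thesis using k[OF that] by (simp add: if_distrib[where f = "\<lambda>x. x * _"] cong: if_cong)
  qed
  then have "(deriv ^^ n) F 0 / fact n = (if n = 0 then k else 0)" for n
    by (rule power_series_coefficient)
  then have "?S = 0" by (intro sum.neutral) auto
  then show ?thesis by simp
next
  case False
  define a where "a = (\<lambda>n. cmod ((deriv ^^ n) F 0 / fact n) / growth_inv \<Psi> (real n))"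
  have good: "(\<Sum>n\<in>{1..N}. a n * R ^ n) \<le> ?M"
    if R: "0 < R" "R < 1" and nz: "\<And>z. cmod z = R \<Longrightarrow> F z \<noteq> 0" for R
  proof -
    define G where "G = (\<lambda>z. F (of_real R * z))"
    have hol: "G holomorphic_on ball 0 (1 / R)"
      unfolding G_def using R
      by (intro holomorphic_on_compose_gen[OF _ F, unfolded o_def] holomorphic_intros)
         (auto simp: norm_mult field_simps)
    have coef: "(deriv ^^ n) G 0 / fact n = of_real (R ^ n) * ((deriv ^^ n) F 0 / fact n)" for n
    proof (rule power_series_coefficient)
      fix z :: complex assume z: "z \<in> ball 0 1"
      have "R * cmod z \<le> 1 * cmod z" using R by (intro mult_right_mono) auto
      then have "of_real R * z \<in> ball 0 1" using z R by (simp add: norm_mult)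
      from holomorphic_power_series[OF F this]
      show "(\<lambda>n. of_real (R ^ n) * ((deriv ^^ n) F 0 / fact n) * z ^ n) sums G z"
        by (simp add: G_def power_mult_distrib mult_ac)
    qed
    have cont: "continuous_on UNIV (\<lambda>x. \<Psi> (cmod (G (circ x))))"
      using g R
      by (intro continuous_on_compose2[of "{0..}" \<Psi> UNIV] continuous_intros
          continuous_on_compose2[OF holomorphic_on_imp_continuous_on[OF hol]])
         (auto simp: growth_function_def)
    then have meas: "(\<lambda>x. \<Psi> (cmod (G (circ x)))) \<in> borel_measurable borel"
      by (rule borel_measurable_continuous_onI)
    have "(\<integral>\<^sup>+\<theta>. ennreal (\<Psi> (cmod (G (circ \<theta>)))) \<partial>unit_interval) =
       (\<integral>\<^sup>+\<theta>\<in>{0..<1}. ennreal (\<Psi> (cmod (F (of_real R * cis (2 * pi * \<theta>))))) \<partial>lborel)"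
      using nn_integral_circle_unit_interval[OF meas] by (simp add: G_def circ_def)
    also have "\<dots> \<le> hardy_modular \<Psi> F"
      unfolding hardy_modular_def using R by (intro SUP_upper) auto
    finally have nn: "(\<integral>\<^sup>+\<theta>. ennreal (\<Psi> (cmod (G (circ \<theta>)))) \<partial>unit_interval) \<le> 1" using mod by simp
    have "ennreal (LINT x|unit_interval. \<Psi> (cmod (G (circ x)))) \<le> 1"
      using nn continuous_on_subset[OF cont] growth_function_nonneg[OF g]
      by (subst nn_integral_eq_integral[symmetric]) (auto intro: continuous_unit_interval_integral)
    then have int: "(LINT x|unit_interval. \<Psi> (cmod (G (circ x)))) \<le> 1" by simp
    have "(\<Sum>n\<in>{1..N}. cmod ((deriv ^^ n) G 0 / fact n) / growth_inv \<Psi> (real n)) \<le> ?M"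
    proof (rule hardy_orlicz_coefficients_on_circle[OF g p c hol _ _ int])
      show "1 < 1 / R" using R by simp
      show "G z \<noteq> 0" if "cmod z = 1" for z
        unfolding G_def using that R by (intro nz) (simp add: norm_mult)
    qed
    also have "(\<Sum>n\<in>{1..N}. cmod ((deriv ^^ n) G 0 / fact n) / growth_inv \<Psi> (real n)) = (\<Sum>n\<in>{1..N}. a n * R ^ n)"
      unfolding coef a_def using R by (intro sum.cong refl) (simp add: norm_mult norm_power norm_divide)
    finally show ?thesis .
  qed
  have "(\<Sum>n\<in>{1..N}. a n * 1 ^ n) \<le> ?M"
  proof (rule ccontr)
    assume "\<not> ?thesis"
    then have gt: "(\<Sum>n\<in>{1..N}. a n * 1 ^ n) > ?M" by simp
    have "((\<lambda>R. \<Sum>n\<in>{1..N}. a n * R ^ n) \<longlongrightarrow> (\<Sum>n\<in>{1..N}. a n * 1 ^ n)) (at_left 1)"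
      by (intro tendsto_intros)
    then have "\<forall>\<^sub>F R in at_left 1. ?M < (\<Sum>n\<in>{1..N}. a n * R ^ n)"
      using gt by (rule order_tendstoD(1))
    then obtain b where b: "b < 1" "\<And>R. b < R \<Longrightarrow> R < 1 \<Longrightarrow> ?M < (\<Sum>n\<in>{1..N}. a n * R ^ n)"
      unfolding eventually_at_left_field by blast
    define m where "m = (1 + max b 0) / 2"
    have m: "max b 0 < m" "m < 1" using b(1) by (auto simp: m_def)
    have "finite {z \<in> cball 0 m. F z = 0}"
      by (rule holomorphic_compact_finite_zeros[OF F _ _ _ _ False]) (use m in auto)
    then have "finite (cmod ` {z \<in> cball 0 m. F z = 0})" by (rule finite_imageI)
    then have "\<not> {max b 0<..<m} \<subseteq> cmod ` {z \<in> cball 0 m. F z = 0}"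
      using infinite_Ioo[OF m(1)] finite_subset by blast
    then obtain R where "R \<in> {max b 0<..<m}" and R0: "R \<notin> cmod ` {z \<in> cball 0 m. F z = 0}" by blast
    then have R: "max b 0 < R" "R < m" by auto
    have "F z \<noteq> 0" if "cmod z = R" for z
    proof
      assume "F z = 0"
      then have "cmod z \<in> cmod ` {z \<in> cball 0 m. F z = 0}" using that R by (intro imageI) simp
      then show False using R0 that by simp
    qed
    then have "(\<Sum>n\<in>{1..N}. a n * R ^ n) \<le> ?M" using R m by (intro good) auto
    then show False using b(2)[of R] R m by simp
  qed
  then show ?thesis by (simp add: a_def)
qed

text \<open>
  The lower type condition makes the modular of \<open>F / \<alpha>\<close> at most \<open>c \<alpha>\<^sup>-\<^sup>p\<close> times that of \<open>F\<close>. So the set of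
  admissible \<open>\<alpha>\<close> is nonempty, and the real infimum that defines the norm takes no default value.
\<close>

lemma hardy_orlicz_rescale:
  assumes g: "growth_function \<Psi> p" and F: "F \<in> hardy_orlicz \<Psi>"
  shows "\<exists>\<alpha>>0. hardy_modular \<Psi> (\<lambda>z. F z / of_real \<alpha>) \<le> 1"
proof -
  obtain c where c: "c > 0" "\<And>s t. 0 < s \<Longrightarrow> s < t \<Longrightarrow> \<Psi> s \<le> c * (s / t) powr p * \<Psi> t"
    using growth_function_lower_type[OF g] by blast
  have p: "p > 0" using g by (simp add: growth_function_def)
  obtain K where K: "hardy_modular \<Psi> F = ennreal K" "K \<ge> 0"
    using F by (cases "hardy_modular \<Psi> F") (auto simp: hardy_orlicz_def)
  define \<alpha> where "\<alpha> = max 2 ((c * (K + 1)) powr (1 / p))"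
  have \<alpha>: "\<alpha> \<ge> 2" by (simp add: \<alpha>_def)
  define \<delta> where "\<delta> = c * (1 / \<alpha>) powr p"
  have d: "0 \<le> \<delta>" using c by (simp add: \<delta>_def)
  have "c * (K + 1) = ((c * (K + 1)) powr (1 / p)) powr p" using c K p by (simp add: powr_powr)
  also have "\<dots> \<le> \<alpha> powr p" using p by (intro powr_mono2) (auto simp: \<alpha>_def)
  finally have "c * (K + 1) / \<alpha> powr p \<le> 1" using \<alpha> by (simp add: divide_le_eq)
  then have dK: "\<delta> * (K + 1) \<le> 1" by (simp add: \<delta>_def powr_divide mult.commute)
  have le: "\<Psi> (t / \<alpha>) \<le> \<delta> * \<Psi> t" if "0 \<le> t" for t
  proof (cases "t = 0")
    case True then show ?thesis using g by (simp add: growth_function_def)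
  next
    case False
    then show ?thesis using c(2)[of "t / \<alpha>" t] that \<alpha> by (simp add: \<delta>_def field_simps)
  qed
  have "hardy_modular \<Psi> (\<lambda>z. F z / of_real \<alpha>) \<le> ennreal \<delta> * hardy_modular \<Psi> F"
    unfolding hardy_modular_def
  proof (rule SUP_least)
    fix r :: real assume r: "r \<in> {0..<1}"
    let ?f = "\<lambda>\<theta>. \<Psi> (cmod (F (of_real r * cis (2 * pi * \<theta>))))"
    have "continuous_on UNIV ?f"
      using g r F
      by (intro continuous_on_compose2[of "{0..}" \<Psi> UNIV] continuous_intros
          continuous_on_compose2[OF holomorphic_on_imp_continuous_on[of F "ball 0 1"]])
         (auto simp: growth_function_def hardy_orlicz_def norm_mult)
    then have "?f \<in> borel_measurable lborel" by (simp add: borel_measurable_continuous_onI)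
    then have m: "(\<lambda>\<theta>. ennreal (?f \<theta>) * indicator {0..<1} \<theta>) \<in> borel_measurable lborel"
      by (intro borel_measurable_times_ennreal borel_measurable_indicator measurable_compose[OF _ measurable_ennreal]) auto
    have "(\<integral>\<^sup>+\<theta>\<in>{0..<1}. ennreal (\<Psi> (cmod (F (of_real r * cis (2 * pi * \<theta>)) / of_real \<alpha>))) \<partial>lborel)
       \<le> (\<integral>\<^sup>+\<theta>. ennreal \<delta> * (ennreal (?f \<theta>) * indicator {0..<1} \<theta>) \<partial>lborel)"
    proof (rule nn_integral_mono)
      fix \<theta>
      have "ennreal (\<Psi> (cmod (F (of_real r * cis (2 * pi * \<theta>)) / of_real \<alpha>))) \<le> ennreal (\<delta> * ?f \<theta>)"
        using le[of "cmod (F (of_real r * cis (2 * pi * \<theta>)))"] \<alpha> by (intro ennreal_leI) (simp add: norm_divide)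
      also have "\<dots> = ennreal \<delta> * ennreal (?f \<theta>)"
        using d growth_function_nonneg[OF g] by (simp add: ennreal_mult)
      finally show "ennreal (\<Psi> (cmod (F (of_real r * cis (2 * pi * \<theta>)) / of_real \<alpha>))) * indicator {0..<1} \<theta>
         \<le> ennreal \<delta> * (ennreal (?f \<theta>) * indicator {0..<1} \<theta>)"
        by (auto simp: indicator_def)
    qed
    also have "\<dots> = ennreal \<delta> * (\<integral>\<^sup>+\<theta>\<in>{0..<1}. ennreal (?f \<theta>) \<partial>lborel)"
      by (rule nn_integral_cmult[OF m])
    also have "\<dots> \<le> ennreal \<delta> * (SUP r\<in>{0..<1}. \<integral>\<^sup>+\<theta>\<in>{0..<1}. ennreal (\<Psi> (cmod (F (of_real r * cis (2 * pi * \<theta>))))) \<partial>lborel)"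
      using r by (intro mult_left_mono SUP_upper) auto
    finally show "(\<integral>\<^sup>+\<theta>\<in>{0..<1}. ennreal (\<Psi> (cmod (F (of_real r * cis (2 * pi * \<theta>)) / of_real \<alpha>))) \<partial>lborel)
      \<le> ennreal \<delta> * (SUP r\<in>{0..<1}. \<integral>\<^sup>+\<theta>\<in>{0..<1}. ennreal (\<Psi> (cmod (F (of_real r * cis (2 * pi * \<theta>))))) \<partial>lborel)" .
  qed
  also have "\<dots> = ennreal (\<delta> * K)" using K d by (simp add: ennreal_mult)
  also have "\<dots> \<le> ennreal 1"
    using dK d K by (intro ennreal_leI) (simp add: distrib_left)
  finally show ?thesis using \<alpha> by (intro exI[of _ \<alpha>]) auto
qed

theorem corollary3:
  fixes \<Psi> :: "real \<Rightarrow> real" and p :: real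
  assumes "growth_function \<Psi> p" and "p \<in> {1/2<..1}"
  shows "\<exists>M>0. \<forall>F\<in>hardy_orlicz \<Psi>. \<forall>f :: nat \<Rightarrow> complex.
           (\<forall>z\<in>ball 0 1. (\<lambda>n. f n * z ^ n) sums F z) \<longrightarrow>
             (\<lambda>n. cmod (f n) / growth_inv \<Psi> (real n)) summable_on {1..} \<and>
             (\<Sum>\<^sub>\<infinity>n\<in>{1..}. cmod (f n) / growth_inv \<Psi> (real n)) \<le> M * hardy_orlicz_norm \<Psi> F"
proof -
  note g = assms(1)
  have p: "p > 1/2" using assms(2) by simp
  obtain c where c: "c > 0" "\<And>s t. 0 < s \<Longrightarrow> s < t \<Longrightarrow> \<Psi> s \<le> c * (s / t) powr p * \<Psi> t"
    using growth_function_lower_type[OF g] by blast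
  define M where "M = 6 * pi * (8 + 65536 * c\<^sup>2)"
  have M: "M > 0" unfolding M_def by (intro mult_pos_pos add_pos_nonneg) auto
  show ?thesis
  proof (intro exI[of _ M] conjI M ballI allI impI)
    fix F and f :: "nat \<Rightarrow> complex"
    assume F: "F \<in> hardy_orlicz \<Psi>" and f: "\<forall>z\<in>ball 0 1. (\<lambda>n. f n * z ^ n) sums F z"
    let ?a = "\<lambda>n. cmod (f n) / growth_inv \<Psi> (real n)"
    have holF: "F holomorphic_on ball 0 1" using F by (simp add: hardy_orlicz_def)
    have a0: "0 \<le> ?a n" for n using growth_inv_props(1)[OF g, of "real n"] by simp
    have partial: "sum ?a S \<le> M * \<alpha>"
      if \<alpha>: "\<alpha> > 0" "hardy_modular \<Psi> (\<lambda>z. F z / of_real \<alpha>) \<le> 1" and S: "finite S" "S \<subseteq> {1..}" for \<alpha> S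
    proof -
      have coef: "(deriv ^^ n) (\<lambda>z. F z / of_real \<alpha>) 0 / fact n = f n / of_real \<alpha>" for n
      proof (rule power_series_coefficient)
        fix z :: complex assume "z \<in> ball 0 1"
        then have "(\<lambda>n. f n * z ^ n) sums F z" using f by blast
        then show "(\<lambda>n. f n / of_real \<alpha> * z ^ n) sums (F z / of_real \<alpha>)"
          by (auto dest: sums_divide[of _ _ "of_real \<alpha>"])
      qed
      obtain N where N: "S \<subseteq> {..N}" using S(1) finite_nat_set_iff_bounded_le by auto
      have "sum ?a S \<le> (\<Sum>n\<in>{1..N}. ?a n)"
        using S N by (intro sum_mono2 a0) auto
      also have "\<dots> = \<alpha> * (\<Sum>n\<in>{1..N}. cmod ((deriv ^^ n) (\<lambda>z. F z / of_real \<alpha>) 0 / fact n) / growth_inv \<Psi> (real n))"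
        unfolding coef sum_distrib_left using \<alpha> by (intro sum.cong refl) (simp add: norm_divide)
      also have "\<dots> \<le> \<alpha> * M"
        unfolding M_def using \<alpha>
        by (intro mult_left_mono hardy_orlicz_coefficients_unit_modular[OF g p c] holomorphic_intros holF) auto
      finally show ?thesis by (simp add: mult.commute)
    qed
    obtain \<alpha>0 where \<alpha>0: "\<alpha>0 > 0" "hardy_modular \<Psi> (\<lambda>z. F z / of_real \<alpha>0) \<le> 1"
      using hardy_orlicz_rescale[OF g F] by blast
    show summable: "?a summable_on {1..}"
      by (rule nonneg_bdd_above_summable_on) (use partial[OF \<alpha>0] a0 in \<open>auto intro!: bdd_aboveI\<close>)
    have "infsum ?a {1..} / M \<le> hardy_orlicz_norm \<Psi> F"
      unfolding hardy_orlicz_norm_def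
    proof (rule cInf_greatest)
      fix \<alpha> assume "\<alpha> \<in> {\<alpha>. \<alpha> > 0 \<and> hardy_modular \<Psi> (\<lambda>z. F z / of_real \<alpha>) \<le> 1}"
      then have "infsum ?a {1..} \<le> M * \<alpha>"
        using partial by (intro infsum_le_finite_sums[OF summable]) auto
      then show "infsum ?a {1..} / M \<le> \<alpha>" using M by (simp add: divide_le_eq mult.commute)
    qed (use \<alpha>0 in auto)
    then show "infsum ?a {1..} \<le> M * hardy_orlicz_norm \<Psi> F"
      using M by (simp add: divide_le_eq mult.commute)
  qed
qed

end
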